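(* Let $w$ be a unitary element of $\mathcal{Q}_2$ such that $wS_1w^*=S_1$. Then $w\in\mathbb{T}1$, i.e. $w$ is a scalar multiple of the identity by a complex number of modulus one.
   Context: The $2$-adic ring $C^*$-algebra $\mathcal{Q}_2$ is the universal (unital) $C^*$-algebra generated by a unitary $U$ and an isometry $S_2$ satisfying $S_2U=U^2S_2$ and $S_2S_2^*+US_2S_2^*U^*=1$. Put $S_1:=US_2$. $\mathbb{T}$ denotes the set of complex numbers of modulus one. *)

theory Defs
  imports Complex_Main "HOL-Algebra.Module" "HOL-Algebra.RingHom"
begin

definition complex_ring :: "complex ring" where
  "complex_ring = \<lparr>carrier = UNIV, mult = (*), one = 1, zero = 0, add = (+)\<rparr>"

lemma complex_ring_simps [simp]:
  "carrier complex_ring = UNIV"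
  "x \<otimes>\<^bsub>complex_ring\<^esub> y = x * y"
  "\<one>\<^bsub>complex_ring\<^esub> = 1"
  "\<zero>\<^bsub>complex_ring\<^esub> = 0"
  "x \<oplus>\<^bsub>complex_ring\<^esub> y = x + y"
  by (simp_all add: complex_ring_def)

lemma cring_complex_ring: "cring complex_ring"
proof (rule cringI)
  show "abelian_group complex_ring"
    by (rule abelian_groupI) (auto simp: algebra_simps intro: exI[of _ "- x" for x] ab_left_minus)
  show "comm_monoid complex_ring"
    by (rule comm_monoidI) (auto simp: algebra_simps)
qed (auto simp: algebra_simps)

record 'a cstar_alg = "(complex, 'a) module" +
  adj :: "'a \<Rightarrow> 'a"
  nrm :: "'a \<Rightarrow> real"

(* Unital C*-algebras on a carrier set. The zero algebra is not excluded; it satisfies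
   the relations below, and admitting it as a target does not affect universality. *)
locale cstar_algebra = ring A + module complex_ring A
  for A :: "('a, 'm) cstar_alg_scheme" (structure) +
  assumes smult_mult_left:
      "\<lbrakk>x \<in> carrier A; y \<in> carrier A\<rbrakk> \<Longrightarrow> (c \<odot> x) \<otimes> y = c \<odot> (x \<otimes> y)"
    and smult_mult_right:
      "\<lbrakk>x \<in> carrier A; y \<in> carrier A\<rbrakk> \<Longrightarrow> x \<otimes> (c \<odot> y) = c \<odot> (x \<otimes> y)"
    and adj_closed: "x \<in> carrier A \<Longrightarrow> adj A x \<in> carrier A"
    and adj_adj: "x \<in> carrier A \<Longrightarrow> adj A (adj A x) = x"
    and adj_add:
      "\<lbrakk>x \<in> carrier A; y \<in> carrier A\<rbrakk> \<Longrightarrow> adj A (x \<oplus> y) = adj A x \<oplus> adj A y"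
    and adj_smult: "x \<in> carrier A \<Longrightarrow> adj A (c \<odot> x) = cnj c \<odot> adj A x"
    and adj_mult:
      "\<lbrakk>x \<in> carrier A; y \<in> carrier A\<rbrakk> \<Longrightarrow> adj A (x \<otimes> y) = adj A y \<otimes> adj A x"
    and nrm_nonneg: "x \<in> carrier A \<Longrightarrow> 0 \<le> nrm A x"
    and nrm_eq_0_iff: "x \<in> carrier A \<Longrightarrow> nrm A x = 0 \<longleftrightarrow> x = \<zero>"
    and nrm_triangle:
      "\<lbrakk>x \<in> carrier A; y \<in> carrier A\<rbrakk> \<Longrightarrow> nrm A (x \<oplus> y) \<le> nrm A x + nrm A y"
    and nrm_smult: "x \<in> carrier A \<Longrightarrow> nrm A (c \<odot> x) = cmod c * nrm A x"
    and nrm_mult: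
      "\<lbrakk>x \<in> carrier A; y \<in> carrier A\<rbrakk> \<Longrightarrow> nrm A (x \<otimes> y) \<le> nrm A x * nrm A y"
    and cstar_identity: "x \<in> carrier A \<Longrightarrow> nrm A (adj A x \<otimes> x) = (nrm A x)\<^sup>2"
    and complete:
      "\<lbrakk>\<And>n::nat. f n \<in> carrier A;
        \<And>e. 0 < e \<Longrightarrow> \<exists>N. \<forall>m\<ge>N. \<forall>n\<ge>N. nrm A (f m \<ominus> f n) < e\<rbrakk>
       \<Longrightarrow> \<exists>l\<in>carrier A. (\<lambda>n. nrm A (f n \<ominus> l)) \<longlonglongrightarrow> 0"

definition cstar_unitary :: "('a, 'm) cstar_alg_scheme \<Rightarrow> 'a \<Rightarrow> bool" where
  "cstar_unitary A u \<longleftrightarrow> u \<in> carrier A \<and>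
     adj A u \<otimes>\<^bsub>A\<^esub> u = \<one>\<^bsub>A\<^esub> \<and> u \<otimes>\<^bsub>A\<^esub> adj A u = \<one>\<^bsub>A\<^esub>"

definition cstar_isometry :: "('a, 'm) cstar_alg_scheme \<Rightarrow> 'a \<Rightarrow> bool" where
  "cstar_isometry A s \<longleftrightarrow> s \<in> carrier A \<and> adj A s \<otimes>\<^bsub>A\<^esub> s = \<one>\<^bsub>A\<^esub>"

(* Unital *-homomorphisms; ring_hom includes preservation of the unit. *)
definition cstar_hom ::
  "('a, 'm) cstar_alg_scheme \<Rightarrow> ('b, 'n) cstar_alg_scheme \<Rightarrow> ('a \<Rightarrow> 'b) set" where
  "cstar_hom A B = {h \<in> ring_hom A B.
     (\<forall>c. \<forall>x\<in>carrier A. h (c \<odot>\<^bsub>A\<^esub> x) = c \<odot>\<^bsub>B\<^esub> h x) \<and>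
     (\<forall>x\<in>carrier A. h (adj A x) = adj B (h x))}"

definition two_adic_relations :: "('a, 'm) cstar_alg_scheme \<Rightarrow> 'a \<Rightarrow> 'a \<Rightarrow> bool" where
  "two_adic_relations A U S2 \<longleftrightarrow>
     cstar_unitary A U \<and> cstar_isometry A S2 \<and>
     S2 \<otimes>\<^bsub>A\<^esub> U = (U [^]\<^bsub>A\<^esub> (2::nat)) \<otimes>\<^bsub>A\<^esub> S2 \<and>
     (S2 \<otimes>\<^bsub>A\<^esub> adj A S2) \<oplus>\<^bsub>A\<^esub>
       (U \<otimes>\<^bsub>A\<^esub> S2 \<otimes>\<^bsub>A\<^esub> adj A S2 \<otimes>\<^bsub>A\<^esub> adj A U) = \<one>\<^bsub>A\<^esub>"

(* Q together with the elements U, S2 is (a model of) the 2-adic ring C*-algebra: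
   the initial object among unital C*-algebras with a pair satisfying the relations.
   The test algebras B have arbitrary carriers inside the type 'a of elements of Q.
   This loses no generality. If Q is nonzero, 'a has at least continuum cardinality.
   The C*-subalgebra generated by a pair in any C*-algebra is separable, so it has at most
   continuum many elements and is isomorphic to some B on 'a. If 'a is too small
   for that, Q is the zero algebra. *)
definition is_two_adic_ring_cstar :: "'a cstar_alg \<Rightarrow> 'a \<Rightarrow> 'a \<Rightarrow> bool" where
  "is_two_adic_ring_cstar Q U S2 \<longleftrightarrow>
     cstar_algebra Q \<and> two_adic_relations Q U S2 \<and>
     (\<forall>(B :: 'a cstar_alg) V T. cstar_algebra B \<and> two_adic_relations B V T \<longrightarrow>
        (\<exists>h\<in>cstar_hom Q B. h U = V \<and> h S2 = T \<and>
           (\<forall>g\<in>cstar_hom Q B. g U = V \<and> g S2 = T \<longrightarrow> (\<forall>x\<in>carrier Q. g x = h x))))"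

end

theory Submission
  imports Defs "HOL-Algebra.Subrings"
begin

text \<open>
  Write \<open>S = S\<^sub>1\<close>. The pair \<open>U, S\<close> satisfies \<open>S\<^sup>*S = 1\<close>, \<open>SU = U\<^sup>2S\<close> and
  \<open>S\<^sup>*US = 0\<close>. A unitary \<open>w\<close> with \<open>wSw\<^sup>* = S\<close> commutes with \<open>S\<close> and \<open>S\<^sup>*\<close>, and the claim is
  that the only elements with this property are the scalars. The picture to keep in mind, up to a
  shift of the index, is
  \<open>S e\<^sub>k = e\<^bsub>2k\<^esub>\<close>, \<open>U e\<^sub>k = e\<^bsub>k+1\<^esub>\<close> on the Hilbert space with orthonormal basis
  \<open>(e\<^sub>k)\<close>, \<open>k\<close> an integer, but the argument takes place in the algebra itself.

  The universal property enters once: mapping the algebra to the closure of the *-algebra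
  generated by \<open>U\<close> and \<open>S\<close> shows that this closure is everything (\<open>two_adic_norm_closure\<close>).

  An element \<open>x\<close> that commutes with \<open>S\<close> equals \<open>S\<^sup>*\<^sup>N x S\<^sup>N\<close> for all \<open>N\<close>. Applied to a
  polynomial in the generators, this compression kills, for large \<open>N\<close>, every term whose total
  translation is nonzero, since a nonzero integer is not divisible by large powers of two. What
  remains is a linear combination of powers of \<open>S\<close> and \<open>S\<^sup>*\<close>. Hence \<open>x\<close> is a norm limit of such
  Laurent polynomials (\<open>commuting_in_closure_laurent\<close>).

  Let \<open>p = 1 - SS\<^sup>*\<close>. Compressing a Laurent polynomial by \<open>p\<close> leaves its constant term, so
  \<open>xp = pxp = cp\<close> for some scalar \<open>c\<close> (\<open>commuting_mult_defect\<close>), and it remains to show that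
  \<open>u = x - c\<close> is zero, knowing \<open>up = 0\<close>. Since \<open>u\<close> commutes with \<open>S\<close>, this gives
  \<open>u = u S\<^sup>nS\<^sup>*\<^sup>n\<close> for all \<open>n\<close>. In the picture, \<open>u\<close> vanishes on all \<open>e\<^sub>k\<close> with \<open>k\<close> nonzero, and
  what must be excluded is a multiple of the projection onto \<open>e\<^sub>0\<close>.

  This is done with \<open>W\<^sub>n\<close>, the sum over \<open>i < n\<close> of the isometries \<open>U\<^sup>k S\<^sup>n\<close> with \<open>k = 2\<^sup>i\<close>. These
  have orthogonal ranges, so \<open>W\<^sub>n\<^sup>*W\<^sub>n = n\<close>, while \<open>u S\<^sup>D W\<^sub>n = 0\<close> because the ranges avoid \<open>e\<^sub>0\<close>.
  Doubling moves each summand to the next one, so the commutator of \<open>S\<close> with \<open>W\<^sub>n\<close> telescopes to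
  a boundary term of norm at most 2, although \<open>W\<^sub>n\<close> itself has size \<open>\<surd>n\<close>. For large \<open>D\<close> the
  element \<open>u S\<^sup>D\<close> is close to a polynomial \<open>q\<close> in \<open>S\<close>, and \<open>q\<close> has bounded commutators with the
  \<open>W\<^sub>n\<close>. Therefore \<open>\<surd>n\<parallel>q\<parallel> = \<parallel>W\<^sub>nq\<parallel>\<close> differs from \<open>\<parallel>qW\<^sub>n\<parallel>\<close> by at most a constant, and the latter
  is at most \<open>\<surd>n\<close> times the error of the approximation. Letting \<open>n\<close> grow shows that \<open>q\<close>, and with
  it \<open>u\<close>, is arbitrarily small (\<open>commuting_annihilating_defect_zero\<close>).
\<close>

section \<open>Norm and adjoint in a unital C*-algebra\<close>

context cstar_algebra
begin

text \<open>
  The scalar ring contributes facts with the same base names as the ring \<^term>\<open>A\<close>; the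
  following declarations make the unqualified names refer to \<^term>\<open>A\<close>.
\<close>

lemma ring_A: "ring A"
  by unfold_locales

lemmas a_assoc = ring.ring_simprules(7)[OF ring_A]
  and l_neg = ring.ring_simprules(9)[OF ring_A]
  and a_comm = ring.ring_simprules(10)[OF ring_A]
  and m_assoc = ring.ring_simprules(11)[OF ring_A]
  and l_distr = ring.ring_simprules(13)[OF ring_A]
  and r_neg = ring.ring_simprules(16)[OF ring_A]
  and r_neg1 = ring.ring_simprules(18)[OF ring_A]
  and r_neg2 = ring.ring_simprules(17)[OF ring_A]
  and minus_add = ring.ring_simprules(19)[OF ring_A]
  and minus_minus = ring.ring_simprules(20)[OF ring_A]
  and a_lcomm = ring.ring_simprules(22)[OF ring_A]
  and r_distr = ring.ring_simprules(23)[OF ring_A]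
  and l_minus = ring.ring_simprules(26)[OF ring_A]
  and r_minus = ring.ring_simprules(27)[OF ring_A]
  and minus_closed = ring.ring_simprules(4)[OF ring_A]
  and a_inv_closed = ring.ring_simprules(3)[OF ring_A]
  and minus_equality = abelian_group.minus_equality[OF ring.is_abelian_group[OF ring_A]]
  and nat_pow_mult = monoid.nat_pow_mult[OF ring.is_monoid[OF ring_A]]
  and nat_pow_Suc2 = monoid.nat_pow_Suc2[OF ring.is_monoid[OF ring_A]]
  and nat_pow_closed = monoid.nat_pow_closed[OF ring.is_monoid[OF ring_A]]

lemmas [simp] = minus_closed adj_closed adj_adj

lemma adj_one [simp]: "adj A \<one> = \<one>"
proof -
  have "\<one> = adj A (adj A \<one> \<otimes> \<one>)" by simp
  also have "\<dots> = adj A \<one> \<otimes> adj A (adj A \<one>)" by (subst adj_mult) auto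
  finally show ?thesis by simp
qed

lemma smult_add: "x \<in> carrier A \<Longrightarrow> (a + b) \<odot> x = a \<odot> x \<oplus> b \<odot> x"
  using smult_l_distr[of a b x] by simp

lemma smult_smult: "x \<in> carrier A \<Longrightarrow> a \<odot> (b \<odot> x) = (a * b) \<odot> x"
  using smult_assoc1[of a b x] by simp

lemma smult_one_left [simp]: "x \<in> carrier A \<Longrightarrow> 1 \<odot> x = x"
  using smult_one[of x] by simp

lemma smult_zero_left [simp]: "x \<in> carrier A \<Longrightarrow> 0 \<odot> x = \<zero>"
  using smult_l_null[of x] by simp

lemma smult_closed_complex [simp, intro]: "x \<in> carrier A \<Longrightarrow> c \<odot> x \<in> carrier A"
  using smult_closed[of c x] by simp

lemma smult_add_right:
  "\<lbrakk>x \<in> carrier A; y \<in> carrier A\<rbrakk> \<Longrightarrow> c \<odot> (x \<oplus> y) = c \<odot> x \<oplus> c \<odot> y"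
  using smult_r_distr[of c x y] by simp

lemma minus_eq_smult: "x \<in> carrier A \<Longrightarrow> \<ominus> x = (- 1) \<odot> x"
proof -
  assume x: "x \<in> carrier A"
  have "(- 1) \<odot> x \<oplus> x = (- 1 + 1) \<odot> x"
    by (subst smult_add) (use x in auto)
  also have "\<dots> = \<zero>" using x by simp
  finally show ?thesis using x by (metis minus_equality smult_closed_complex)
qed

lemma adj_zero [simp]: "adj A \<zero> = \<zero>"
  using adj_smult[of \<zero> 0] by simp

lemma adj_uminus: "x \<in> carrier A \<Longrightarrow> adj A (\<ominus> x) = \<ominus> adj A x"
  by (simp add: minus_eq_smult adj_smult)

lemma adj_diff:
  "\<lbrakk>x \<in> carrier A; y \<in> carrier A\<rbrakk> \<Longrightarrow> adj A (x \<ominus> y) = adj A x \<ominus> adj A y"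
  by (simp add: a_minus_def adj_add adj_uminus)

lemma adj_pow: "x \<in> carrier A \<Longrightarrow> adj A (x [^] (n::nat)) = adj A x [^] n"
proof (induction n)
  case (Suc n)
  then have "adj A (x [^] Suc n) = adj A x \<otimes> adj A x [^] n" by (simp add: adj_mult)
  also have "\<dots> = adj A x [^] Suc n" using Suc.prems by (simp only: nat_pow_Suc2 adj_closed)
  finally show ?case .
qed simp

lemma diff_mult_left:
  "\<lbrakk>x \<in> carrier A; y \<in> carrier A; z \<in> carrier A\<rbrakk> \<Longrightarrow> (x \<ominus> y) \<otimes> z = x \<otimes> z \<ominus> y \<otimes> z"
  by (simp add: a_minus_def l_distr l_minus)

lemma diff_mult_right:
  "\<lbrakk>x \<in> carrier A; y \<in> carrier A; z \<in> carrier A\<rbrakk> \<Longrightarrow> z \<otimes> (x \<ominus> y) = z \<otimes> x \<ominus> z \<otimes> y"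
  by (simp add: a_minus_def r_distr r_minus)

lemma smult_diff_right:
  "\<lbrakk>x \<in> carrier A; y \<in> carrier A\<rbrakk> \<Longrightarrow> c \<odot> (x \<ominus> y) = c \<odot> x \<ominus> c \<odot> y"
  by (simp add: a_minus_def minus_eq_smult smult_add_right smult_smult)

lemma smult_diff_left: "x \<in> carrier A \<Longrightarrow> (a - b) \<odot> x = a \<odot> x \<ominus> b \<odot> x"
  using smult_add[of x a "- b"] by (simp add: a_minus_def minus_eq_smult smult_smult)

lemma diff_add_diff:
  "\<lbrakk>x \<in> carrier A; y \<in> carrier A; z \<in> carrier A\<rbrakk> \<Longrightarrow> (x \<ominus> y) \<oplus> (y \<ominus> z) = x \<ominus> z"
  by (simp add: a_minus_def a_assoc r_neg1 r_neg2)

lemma add_diff_add: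
  "\<lbrakk>x \<in> carrier A; y \<in> carrier A; a \<in> carrier A; b \<in> carrier A\<rbrakk>
    \<Longrightarrow> (x \<oplus> y) \<ominus> (a \<oplus> b) = (x \<ominus> a) \<oplus> (y \<ominus> b)"
  by (simp add: a_minus_def minus_add a_assoc a_comm a_lcomm)

lemma diff_self [simp]: "x \<in> carrier A \<Longrightarrow> x \<ominus> x = \<zero>"
  by (simp add: a_minus_def r_neg)

lemma eq_if_diff_zero:
  "\<lbrakk>x \<in> carrier A; y \<in> carrier A; x \<ominus> y = \<zero>\<rbrakk> \<Longrightarrow> x = y"
  by (metis a_minus_def minus_equality minus_minus a_inv_closed)

lemma nrm_zero [simp]: "nrm A \<zero> = 0"
  using nrm_eq_0_iff[of \<zero>] by simp

lemma nrm_uminus: "x \<in> carrier A \<Longrightarrow> nrm A (\<ominus> x) = nrm A x"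
  by (simp add: minus_eq_smult nrm_smult)

lemma diff_swap: "\<lbrakk>x \<in> carrier A; y \<in> carrier A\<rbrakk> \<Longrightarrow> y \<ominus> x = \<ominus> (x \<ominus> y)"
  by (simp add: a_minus_def minus_add a_comm)

lemma nrm_diff_commute:
  "\<lbrakk>x \<in> carrier A; y \<in> carrier A\<rbrakk> \<Longrightarrow> nrm A (y \<ominus> x) = nrm A (x \<ominus> y)"
  by (metis diff_swap minus_closed nrm_uminus)

lemma nrm_diff_triangle:
  "\<lbrakk>x \<in> carrier A; y \<in> carrier A; z \<in> carrier A\<rbrakk>
    \<Longrightarrow> nrm A (x \<ominus> z) \<le> nrm A (x \<ominus> y) + nrm A (y \<ominus> z)"
  by (metis diff_add_diff minus_closed nrm_triangle)

lemma nrm_triangle_diff: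
  "\<lbrakk>x \<in> carrier A; y \<in> carrier A\<rbrakk> \<Longrightarrow> nrm A x \<le> nrm A (x \<ominus> y) + nrm A y"
  using nrm_diff_triangle[of x y \<zero>] by (simp add: a_minus_def)

lemma nrm_adj_le: "x \<in> carrier A \<Longrightarrow> nrm A x \<le> nrm A (adj A x)"
proof -
  assume x: "x \<in> carrier A"
  have "(nrm A x)\<^sup>2 \<le> nrm A (adj A x) * nrm A x"
    using cstar_identity[OF x] nrm_mult[of "adj A x" x] x by simp
  then show ?thesis
    using nrm_nonneg[OF x] nrm_nonneg[OF adj_closed[OF x]]
    by (cases "nrm A x = 0") (auto simp: power2_eq_square)
qed

lemma nrm_adj: "x \<in> carrier A \<Longrightarrow> nrm A (adj A x) = nrm A x"
  using nrm_adj_le[of x] nrm_adj_le[of "adj A x"] by simp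

lemma nrm_one_le: "nrm A \<one> \<le> 1"
proof -
  have "(nrm A \<one>)\<^sup>2 = nrm A \<one>" using cstar_identity[of \<one>] by simp
  then show ?thesis by (auto simp: power2_eq_square)
qed

lemma nrm_isometry_le:
  assumes "x \<in> carrier A" "adj A x \<otimes> x = \<one>"
  shows "nrm A x \<le> 1"
  using cstar_identity[of x] nrm_one_le assms by (simp add: abs_square_le_1)

lemma nrm_mult_le_left:
  "\<lbrakk>x \<in> carrier A; y \<in> carrier A; nrm A x \<le> 1\<rbrakk> \<Longrightarrow> nrm A (x \<otimes> y) \<le> nrm A y"
  using nrm_mult[of x y] nrm_nonneg[of y] mult_right_mono[of "nrm A x" 1 "nrm A y"] by simp

lemma nrm_mult_le_right:
  "\<lbrakk>x \<in> carrier A; y \<in> carrier A; nrm A y \<le> 1\<rbrakk> \<Longrightarrow> nrm A (x \<otimes> y) \<le> nrm A x"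
  using nrm_mult[of x y] nrm_nonneg[of x] mult_left_mono[of "nrm A y" 1 "nrm A x"] by simp

lemma zero_if_nrm_small:
  assumes "x \<in> carrier A" "\<And>e. e > 0 \<Longrightarrow> nrm A x \<le> e"
  shows "x = \<zero>"
  using field_le_epsilon[of "nrm A x" 0] assms nrm_eq_0_iff[of x] nrm_nonneg[of x] by force

text \<open>
  The line spanned by one element is complete, being a rescaled copy of the complex plane or
  zero. The limit scalar is needed explicitly, since it is the constant that gets subtracted from
  an element of the commutant.
\<close>

lemma scalar_multiples_closed:
  assumes x: "x \<in> carrier A" and p: "p \<in> carrier A"
    and approx: "\<And>e. e > 0 \<Longrightarrow> \<exists>c. nrm A (x \<ominus> c \<odot> p) < e"
  shows "\<exists>c. x = c \<odot> p"
proof (cases "nrm A p = 0")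
  case True
  then have "p = \<zero>" using p nrm_eq_0_iff by blast
  with approx have "nrm A x \<le> e" if "e > 0" for e
    using that x by (fastforce simp: a_minus_def)
  then have "x = \<zero>" using zero_if_nrm_small x by blast
  then show ?thesis using \<open>p = \<zero>\<close> by auto
next
  case False
  then have pos: "nrm A p > 0" using nrm_nonneg[OF p] by simp
  have "\<exists>c. nrm A (x \<ominus> c \<odot> p) < inverse (real (Suc n))" for n
    using approx[of "inverse (real (Suc n))"] by simp
  then obtain c where c: "\<And>n. nrm A (x \<ominus> c n \<odot> p) < inverse (real (Suc n))"
    by metis
  have cd: "cmod (a - b) * nrm A p \<le> nrm A (x \<ominus> a \<odot> p) + nrm A (x \<ominus> b \<odot> p)" for a b
  proof -
    have "cmod (a - b) * nrm A p = nrm A (a \<odot> p \<ominus> b \<odot> p)"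
      using p by (simp add: nrm_smult[symmetric] smult_diff_left)
    also have "\<dots> \<le> nrm A (a \<odot> p \<ominus> x) + nrm A (x \<ominus> b \<odot> p)"
      using x p by (simp add: nrm_diff_triangle)
    finally show ?thesis using x p by (simp add: nrm_diff_commute)
  qed
  have "Cauchy c"
  proof (rule metric_CauchyI)
    fix e :: real assume e: "e > 0"
    obtain N where N: "inverse (real (Suc N)) < e * nrm A p / 2"
      using reals_Archimedean[of "e * nrm A p / 2"] e pos by auto
    have small: "nrm A (x \<ominus> c n \<odot> p) < e * nrm A p / 2" if "n \<ge> N" for n
    proof -
      have "inverse (real (Suc n)) \<le> inverse (real (Suc N))" using that by simp
      then show ?thesis using c[of n] N by linarith
    qed
    have "dist (c m) (c n) < e" if "m \<ge> N" "n \<ge> N" for m n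
    proof -
      have "cmod (c m - c n) * nrm A p < e * nrm A p"
        using cd[of "c m" "c n"] small[OF that(1)] small[OF that(2)] by linarith
      then show ?thesis using pos by (simp add: dist_norm)
    qed
    then show "\<exists>M. \<forall>m\<ge>M. \<forall>n\<ge>M. dist (c m) (c n) < e" by blast
  qed
  then obtain l where l: "c \<longlonglongrightarrow> l"
    by (auto simp: Cauchy_convergent_iff convergent_def)
  have "nrm A (x \<ominus> l \<odot> p) \<le> inverse (real (Suc n)) + cmod (c n - l) * nrm A p" for n
  proof -
    have "nrm A (x \<ominus> l \<odot> p) \<le> nrm A (x \<ominus> c n \<odot> p) + nrm A (c n \<odot> p \<ominus> l \<odot> p)"
      using x p by (simp add: nrm_diff_triangle)
    also have "nrm A (c n \<odot> p \<ominus> l \<odot> p) = cmod (c n - l) * nrm A p"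
      using p by (simp add: nrm_smult[symmetric] smult_diff_left)
    finally show ?thesis using c[of n] by linarith
  qed
  moreover have "(\<lambda>n. inverse (real (Suc n)) + cmod (c n - l) * nrm A p)
      \<longlonglongrightarrow> 0 + cmod (l - l) * nrm A p"
    by (intro tendsto_intros LIMSEQ_inverse_real_of_nat l)
  ultimately have "nrm A (x \<ominus> l \<odot> p) \<le> 0 + cmod (l - l) * nrm A p"
    by (intro LIMSEQ_le_const) auto
  then have "x \<ominus> l \<odot> p = \<zero>"
    using x p nrm_nonneg[of "x \<ominus> l \<odot> p"] nrm_eq_0_iff[of "x \<ominus> l \<odot> p"] by auto
  then show ?thesis using eq_if_diff_zero x p by blast
qed

end

section \<open>Norm closures of *-subalgebras\<close>

definition norm_closure :: "('a, 'm) cstar_alg_scheme \<Rightarrow> 'a set \<Rightarrow> 'a set" where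
  "norm_closure A X = {x \<in> carrier A. \<forall>e>0. \<exists>y\<in>X. nrm A (x \<ominus>\<^bsub>A\<^esub> y) < e}"

definition star_subalgebra :: "('a, 'm) cstar_alg_scheme \<Rightarrow> 'a set \<Rightarrow> bool" where
  "star_subalgebra A X \<longleftrightarrow> X \<subseteq> carrier A \<and> \<one>\<^bsub>A\<^esub> \<in> X \<and>
     (\<forall>x\<in>X. \<forall>y\<in>X. x \<oplus>\<^bsub>A\<^esub> y \<in> X \<and> x \<otimes>\<^bsub>A\<^esub> y \<in> X) \<and>
     (\<forall>x\<in>X. adj A x \<in> X \<and> (\<forall>c. c \<odot>\<^bsub>A\<^esub> x \<in> X))"

inductive_set star_algebra_generated ::
  "('a, 'm) cstar_alg_scheme \<Rightarrow> 'a set \<Rightarrow> 'a set" for A G where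
  incl: "x \<in> G \<Longrightarrow> x \<in> star_algebra_generated A G"
| one: "\<one>\<^bsub>A\<^esub> \<in> star_algebra_generated A G"
| add: "\<lbrakk>x \<in> star_algebra_generated A G; y \<in> star_algebra_generated A G\<rbrakk>
    \<Longrightarrow> x \<oplus>\<^bsub>A\<^esub> y \<in> star_algebra_generated A G"
| mult: "\<lbrakk>x \<in> star_algebra_generated A G; y \<in> star_algebra_generated A G\<rbrakk>
    \<Longrightarrow> x \<otimes>\<^bsub>A\<^esub> y \<in> star_algebra_generated A G"
| smult: "x \<in> star_algebra_generated A G \<Longrightarrow> c \<odot>\<^bsub>A\<^esub> x \<in> star_algebra_generated A G"
| adj: "x \<in> star_algebra_generated A G \<Longrightarrow> adj A x \<in> star_algebra_generated A G"

context cstar_algebra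
begin

lemma star_subalgebra_generated:
  assumes "G \<subseteq> carrier A"
  shows "star_subalgebra A (star_algebra_generated A G)"
proof -
  have "x \<in> carrier A" if "x \<in> star_algebra_generated A G" for x
    using that by induction (use assms in auto)
  then show ?thesis
    unfolding star_subalgebra_def by (auto intro: star_algebra_generated.intros)
qed

lemma subset_norm_closure: "X \<subseteq> carrier A \<Longrightarrow> X \<subseteq> norm_closure A X"
  unfolding norm_closure_def by force

lemma norm_closure_mult:
  assumes X: "star_subalgebra A X" and x: "x \<in> norm_closure A X" and y: "y \<in> norm_closure A X"
  shows "x \<otimes> y \<in> norm_closure A X"
proof -
  have carr: "x \<in> carrier A" "y \<in> carrier A" using x y by (auto simp: norm_closure_def)
  have "\<exists>z\<in>X. nrm A (x \<otimes> y \<ominus> z) < e" if e: "e > 0" for e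
  proof -
    define d where "d = e / (nrm A x + nrm A y + 1)"
    define d1 where "d1 = min 1 d"
    have s: "nrm A x + nrm A y + 1 > 0" using carr nrm_nonneg[of x] nrm_nonneg[of y] by simp
    have d: "d > 0" "d1 > 0" "d1 \<le> d" "d1 \<le> 1" using e s by (auto simp: d_def d1_def)
    obtain a b where ab: "a \<in> X" "b \<in> X" "nrm A (x \<ominus> a) < d1" "nrm A (y \<ominus> b) < d1"
      using x y d unfolding norm_closure_def by blast
    have c: "a \<in> carrier A" "b \<in> carrier A" using ab X by (auto simp: star_subalgebra_def)
    have "nrm A a \<le> nrm A (a \<ominus> x) + nrm A x" using c carr nrm_triangle_diff by blast
    then have a: "nrm A a \<le> 1 + nrm A x"
      using ab d c carr by (simp add: nrm_diff_commute[of x a])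
    have "nrm A (x \<otimes> y \<ominus> a \<otimes> b) \<le> nrm A (x \<otimes> y \<ominus> a \<otimes> y) + nrm A (a \<otimes> y \<ominus> a \<otimes> b)"
      using c carr by (simp add: nrm_diff_triangle)
    also have "\<dots> = nrm A ((x \<ominus> a) \<otimes> y) + nrm A (a \<otimes> (y \<ominus> b))"
      using c carr by (simp add: diff_mult_left diff_mult_right)
    also have "\<dots> \<le> nrm A (x \<ominus> a) * nrm A y + nrm A a * nrm A (y \<ominus> b)"
      using c carr by (intro add_mono nrm_mult) auto
    also have "\<dots> \<le> nrm A (x \<ominus> a) * nrm A y + (1 + nrm A x) * nrm A (y \<ominus> b)"
      using a c carr by (intro add_left_mono mult_right_mono nrm_nonneg) auto
    also have "\<dots> < d * nrm A y + (1 + nrm A x) * d"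
    proof (rule add_le_less_mono)
      show "nrm A (x \<ominus> a) * nrm A y \<le> d * nrm A y"
        using ab d carr nrm_nonneg[of y] by (intro mult_right_mono) auto
      show "(1 + nrm A x) * nrm A (y \<ominus> b) < (1 + nrm A x) * d"
        using ab d carr nrm_nonneg[of x] by (intro mult_strict_left_mono) auto
    qed
    also have "\<dots> = d * (nrm A x + nrm A y + 1)" by (simp add: algebra_simps)
    also have "\<dots> = e" using s by (simp add: d_def)
    finally show ?thesis using ab X by (auto simp: star_subalgebra_def)
  qed
  then show ?thesis using carr by (simp add: norm_closure_def)
qed

lemma norm_closure_add:
  assumes X: "star_subalgebra A X" and x: "x \<in> norm_closure A X" and y: "y \<in> norm_closure A X"
  shows "x \<oplus> y \<in> norm_closure A X"
proof -
  have carr: "x \<in> carrier A" "y \<in> carrier A" using x y by (auto simp: norm_closure_def)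
  have "\<exists>z\<in>X. nrm A (x \<oplus> y \<ominus> z) < e" if e: "e > 0" for e
  proof -
    obtain a b where ab: "a \<in> X" "b \<in> X" "nrm A (x \<ominus> a) < e / 2" "nrm A (y \<ominus> b) < e / 2"
      using x y e half_gt_zero unfolding norm_closure_def by blast
    have c: "a \<in> carrier A" "b \<in> carrier A" using ab X by (auto simp: star_subalgebra_def)
    have "nrm A ((x \<oplus> y) \<ominus> (a \<oplus> b)) \<le> nrm A (x \<ominus> a) + nrm A (y \<ominus> b)"
      using c carr by (simp add: add_diff_add nrm_triangle)
    then show ?thesis using ab X by (intro bexI[of _ "a \<oplus> b"]) (auto simp: star_subalgebra_def)
  qed
  then show ?thesis using carr by (simp add: norm_closure_def)
qed

lemma norm_closure_adj:
  assumes X: "star_subalgebra A X" and x: "x \<in> norm_closure A X"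
  shows "adj A x \<in> norm_closure A X"
proof -
  have carr: "x \<in> carrier A" using x by (auto simp: norm_closure_def)
  have "\<exists>z\<in>X. nrm A (adj A x \<ominus> z) < e" if e: "e > 0" for e
  proof -
    obtain a where a: "a \<in> X" "nrm A (x \<ominus> a) < e"
      using x e unfolding norm_closure_def by blast
    have c: "a \<in> carrier A" using a X by (auto simp: star_subalgebra_def)
    then have "nrm A (adj A x \<ominus> adj A a) = nrm A (x \<ominus> a)"
      using carr by (simp add: adj_diff[symmetric] nrm_adj)
    then show ?thesis using a X by (intro bexI[of _ "adj A a"]) (auto simp: star_subalgebra_def)
  qed
  then show ?thesis using carr by (simp add: norm_closure_def)
qed

lemma star_subalgebra_norm_closure:
  assumes X: "star_subalgebra A X"
  shows "star_subalgebra A (norm_closure A X)"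
proof -
  have sub: "X \<subseteq> norm_closure A X"
    using X subset_norm_closure by (auto simp: star_subalgebra_def)
  have sm: "c \<odot> x \<in> norm_closure A X" if x: "x \<in> norm_closure A X" for c x
  proof -
    have "c \<odot> \<one> \<in> norm_closure A X" using X sub by (auto simp: star_subalgebra_def)
    from norm_closure_mult[OF X this x] show ?thesis
      using x by (simp add: smult_mult_left norm_closure_def)
  qed
  show ?thesis
    unfolding star_subalgebra_def
    using sub X sm norm_closure_add[OF X] norm_closure_mult[OF X] norm_closure_adj[OF X]
    by (auto simp: star_subalgebra_def norm_closure_def)
qed

lemma star_subalgebra_uminus: "\<lbrakk>star_subalgebra A X; x \<in> X\<rbrakk> \<Longrightarrow> \<ominus> x \<in> X"
  by (auto simp: star_subalgebra_def minus_eq_smult subset_iff)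

text \<open>
  This makes the closure of a *-subalgebra an admissible target for the universal property.
\<close>

lemma cstar_algebra_norm_closure:
  assumes X: "star_subalgebra A X"
  shows "cstar_algebra (A\<lparr>carrier := norm_closure A X\<rparr>)"
proof -
  let ?Y = "norm_closure A X" let ?B = "A\<lparr>carrier := norm_closure A X\<rparr>"
  have Y: "star_subalgebra A ?Y" by (rule star_subalgebra_norm_closure[OF X])
  have sub: "x \<in> carrier A" if "x \<in> ?Y" for x using that by (simp add: norm_closure_def)
  have Y_adj: "adj A x \<in> ?Y" if "x \<in> ?Y" for x
    using Y that by (simp add: star_subalgebra_def)
  have subring: "subring ?Y A"
    using Y star_subalgebra_uminus[OF Y] by (intro ring.subringI[OF ring_A]) (auto simp: star_subalgebra_def)
  have ring: "ring ?B" by (rule ring.subring_is_ring[OF ring_A subring])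
  \<comment> \<open>The inverse is defined through the carrier, so its agreement in the two structures is a fact.\<close>
  have neg: "a_inv ?B x = \<ominus> x" if "x \<in> ?Y" for x
    by (rule abelian_group.minus_equality[OF ring.is_abelian_group[OF ring]])
       (use that sub[OF that] star_subalgebra_uminus[OF Y that] in \<open>simp_all add: l_neg\<close>)
  have diff: "x \<ominus>\<^bsub>?B\<^esub> y = x \<ominus> y" if "x \<in> ?Y" "y \<in> ?Y" for x y
    using that neg by (simp add: a_minus_def)
  have module: "module complex_ring ?B"
    using Y sub
    by (intro module.intro cring_complex_ring ring.is_abelian_group[OF ring] module_axioms.intro)
       (auto simp: star_subalgebra_def smult_add smult_add_right smult_smult)
  show ?thesis
  proof (intro cstar_algebra.intro ring module cstar_algebra_axioms.intro, goal_cases)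
    case (14 f)
    have f: "f n \<in> ?Y" for n using 14(1) by simp
    obtain l where l: "l \<in> carrier A" "(\<lambda>n. nrm A (f n \<ominus> l)) \<longlonglongrightarrow> 0"
      using complete[of f] 14(2) f sub diff by auto
    have "l \<in> ?Y"
    proof -
      have "\<exists>z\<in>X. nrm A (l \<ominus> z) < e" if e: "e > 0" for e
      proof -
        have "\<forall>\<^sub>F n in sequentially. nrm A (f n \<ominus> l) < e / 2"
          using order_tendstoD(2)[OF l(2), of "e / 2"] e by simp
        then obtain n where n: "nrm A (f n \<ominus> l) < e / 2"
          by (auto simp: eventually_sequentially)
        obtain z where z: "z \<in> X" "nrm A (f n \<ominus> z) < e / 2"
          using f[of n] e half_gt_zero unfolding norm_closure_def by blast
        have "z \<in> carrier A" using X z by (auto simp: star_subalgebra_def)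
        then have "nrm A (l \<ominus> z) \<le> nrm A (f n \<ominus> l) + nrm A (f n \<ominus> z)"
          using nrm_diff_triangle[of l "f n" z] nrm_diff_commute[of "f n" l] l sub[OF f] by simp
        then show ?thesis using n z by (intro bexI[of _ z]) auto
      qed
      then show ?thesis using l by (simp add: norm_closure_def)
    qed
    with l(2) show ?case by (intro bexI[of _ l]) (simp_all add: diff[OF f])
  qed (simp_all add: sub Y_adj smult_mult_left smult_mult_right adj_add adj_smult
         adj_mult nrm_nonneg nrm_eq_0_iff nrm_triangle nrm_smult nrm_mult cstar_identity)
qed

end

section \<open>Integer powers of U and their compressions by S\<close>

text \<open>
  In the picture \<open>S e\<^sub>k = e\<^bsub>2k\<^esub>\<close>, \<open>U e\<^sub>k = e\<^bsub>k+1\<^esub>\<close> the last relation says that doubling has even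
  values only. The pair \<open>U, S\<^sub>1\<close> is of this kind because \<open>S\<^sub>1 = U\<^sup>-\<^sup>1S\<^sub>2U\<close>.
\<close>

locale doubling_pair = cstar_algebra A for A :: "('a, 'm) cstar_alg_scheme" (structure) +
  fixes U S :: 'a
  assumes U_closed [simp, intro]: "U \<in> carrier A"
    and S_closed [simp, intro]: "S \<in> carrier A"
    and adj_U_U: "adj A U \<otimes> U = \<one>"
    and U_adj_U: "U \<otimes> adj A U = \<one>"
    and adj_S_S: "adj A S \<otimes> S = \<one>"
    and S_U: "S \<otimes> U = U \<otimes> (U \<otimes> S)"
    and adj_S_U_S: "adj A S \<otimes> (U \<otimes> S) = \<zero>"
begin

text \<open>
  This rule rewrites powers with a natural exponent \<open>nat a\<close> into powers with integer exponents,
  which would hide the case distinction in the definition of \<open>upow\<close>.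
\<close>

declare pow_nat [simp del]

text \<open>
  Integer powers of the unitary \<open>U\<close>, so that translations in both directions and their
  composition are handled by integer arithmetic.
\<close>

definition upow :: "int \<Rightarrow> 'a" where
  "upow a = (if 0 \<le> a then U [^] nat a else adj A U [^] nat (- a))"

lemma upow_closed [simp, intro]: "upow a \<in> carrier A"
  by (simp add: upow_def)

lemma upow_0 [simp]: "upow 0 = \<one>" and upow_1 [simp]: "upow 1 = U"
  and upow_minus_1: "upow (- 1) = adj A U"
  by (simp_all add: upow_def)

lemma cancel_left:
  assumes "x \<in> carrier A" "y \<in> carrier A" "z \<in> carrier A" "x \<otimes> y = \<one>"
  shows "x \<otimes> (y \<otimes> z) = z"
  using assms by (simp flip: m_assoc)

lemma upow_succ: "U \<otimes> upow a = upow (a + 1)"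
proof (cases "0 \<le> a")
  case True
  then have "nat (a + 1) = Suc (nat a)" by simp
  then show ?thesis using True nat_pow_Suc2[of U "nat a"] by (simp add: upow_def del: nat_pow_Suc)
next
  case False
  then have e: "nat (- a) = Suc (nat (- (a + 1)))" by simp
  have "U \<otimes> upow a = U \<otimes> (adj A U \<otimes> adj A U [^] nat (- (a + 1)))"
    using False nat_pow_Suc2[of "adj A U" "nat (- (a + 1))"]
    by (simp add: upow_def e del: nat_pow_Suc)
  also have "\<dots> = adj A U [^] nat (- (a + 1))"
    by (rule cancel_left) (simp_all add: U_adj_U)
  also have "\<dots> = upow (a + 1)"
    using False by (cases "a = -1") (simp_all add: upow_def)
  finally show ?thesis .
qed

lemma upow_pred: "adj A U \<otimes> upow a = upow (a - 1)"
  using upow_succ[of "a - 1"] cancel_left[of "adj A U" U "upow (a - 1)"] by (simp add: adj_U_U)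

lemma upow_add: "upow a \<otimes> upow b = upow (a + b)"
proof (induction a rule: int_induct[where k = 0])
  case (step1 i)
  have "upow (i + 1) \<otimes> upow b = U \<otimes> (upow i \<otimes> upow b)"
    by (simp add: upow_succ[symmetric] m_assoc)
  then show ?case using step1 by (simp add: upow_succ algebra_simps)
next
  case (step2 i)
  have "upow (i - 1) \<otimes> upow b = adj A U \<otimes> (upow i \<otimes> upow b)"
    by (simp add: upow_pred[symmetric] m_assoc)
  then show ?case using step2 by (simp add: upow_pred algebra_simps)
qed simp

lemma upow_add_left: "x \<in> carrier A \<Longrightarrow> upow a \<otimes> (upow b \<otimes> x) = upow (a + b) \<otimes> x"
  by (simp add: upow_add flip: m_assoc)

lemma adj_upow: "adj A (upow a) = upow (- a)"
proof (induction a rule: int_induct[where k = 0])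
  case (step1 i)
  have "adj A (upow (i + 1)) = adj A (upow i) \<otimes> upow (- 1)"
    by (simp add: upow_succ[symmetric] adj_mult upow_minus_1)
  then show ?case using step1 by (simp add: upow_add algebra_simps)
next
  case (step2 i)
  have "adj A (upow (i - 1)) = adj A (upow i) \<otimes> upow 1"
    by (simp add: upow_pred[symmetric] adj_mult)
  then show ?case using step2 by (simp add: upow_add algebra_simps del: upow_1)
qed simp

lemma nrm_S: "nrm A S \<le> 1"
  by (rule nrm_isometry_le) (simp_all add: adj_S_S)

lemma S_adj_U: "S \<otimes> adj A U = upow (- 2) \<otimes> S"
proof -
  have "upow (- 2) \<otimes> S = upow (- 2) \<otimes> (S \<otimes> (U \<otimes> adj A U))" by (simp add: U_adj_U)
  also have "\<dots> = upow (- 2) \<otimes> ((S \<otimes> U) \<otimes> adj A U)" by (simp add: m_assoc)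
  also have "\<dots> = upow (- 2) \<otimes> (upow 1 \<otimes> (upow 1 \<otimes> (S \<otimes> adj A U)))"
    by (simp add: S_U m_assoc)
  also have "\<dots> = S \<otimes> adj A U" by (simp add: upow_add_left del: upow_1)
  finally show ?thesis by simp
qed

lemma S_upow: "S \<otimes> upow a = upow (2 * a) \<otimes> S"
proof (induction a rule: int_induct[where k = 0])
  case (step1 i)
  have "S \<otimes> upow (i + 1) = (S \<otimes> U) \<otimes> upow i"
    by (simp add: upow_succ[symmetric] m_assoc)
  also have "\<dots> = upow 1 \<otimes> (upow 1 \<otimes> (S \<otimes> upow i))" by (simp add: S_U m_assoc)
  finally show ?case using step1 by (simp add: upow_add_left algebra_simps del: upow_1)
next
  case (step2 i)
  have "S \<otimes> upow (i - 1) = (S \<otimes> adj A U) \<otimes> upow i"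
    by (simp add: upow_pred[symmetric] m_assoc)
  also have "\<dots> = upow (- 2) \<otimes> (S \<otimes> upow i)" by (simp add: S_adj_U m_assoc)
  finally show ?case using step2 by (simp add: upow_add_left algebra_simps)
qed simp

lemma adj_S_upow_even: "adj A S \<otimes> upow (2 * a) = upow a \<otimes> adj A S"
proof -
  have "adj A (S \<otimes> upow (- a)) = adj A (upow (- (2 * a)) \<otimes> S)" by (simp add: S_upow)
  then show ?thesis by (simp add: adj_mult adj_upow)
qed

lemma compress_upow_even: "adj A S \<otimes> (upow (2 * a) \<otimes> S) = upow a"
  by (simp add: S_upow[symmetric]) (simp add: cancel_left adj_S_S)

lemma compress_upow_odd:
  assumes "odd a"
  shows "adj A S \<otimes> (upow a \<otimes> S) = \<zero>"
proof -
  obtain b where b: "a = 1 + 2 * b" using assms by (elim oddE) simp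
  have "adj A S \<otimes> (upow a \<otimes> S) = adj A S \<otimes> (U \<otimes> (upow (2 * b) \<otimes> S))"
    by (simp add: b upow_add[symmetric] m_assoc)
  also have "\<dots> = adj A S \<otimes> (U \<otimes> S) \<otimes> upow b" by (simp add: S_upow[symmetric] m_assoc)
  finally show ?thesis by (simp add: adj_S_U_S)
qed

lemma S_pow_cancel: "adj A S [^] (n::nat) \<otimes> S [^] n = \<one>"
proof (induction n)
  case (Suc n)
  have "adj A S [^] Suc n \<otimes> S [^] Suc n = adj A S [^] n \<otimes> (adj A S \<otimes> (S \<otimes> S [^] n))"
    using nat_pow_Suc2[of S n] by (simp add: m_assoc)
  then show ?case using Suc by (simp add: cancel_left adj_S_S)
qed simp

lemma nrm_S_pow: "nrm A (S [^] (n::nat)) \<le> 1" and nrm_adj_S_pow: "nrm A (adj A S [^] (n::nat)) \<le> 1"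
proof -
  show "nrm A (S [^] n) \<le> 1"
    by (rule nrm_isometry_le) (simp_all add: S_pow_cancel adj_pow)
  then show "nrm A (adj A S [^] n) \<le> 1"
    by (metis S_closed adj_pow nrm_adj nat_pow_closed)
qed

lemma S_pow_upow: "S [^] (n::nat) \<otimes> upow a = upow (2 ^ n * a) \<otimes> S [^] n"
proof (induction n arbitrary: a)
  case (Suc n)
  have "S [^] Suc n \<otimes> upow a = S [^] n \<otimes> upow (2 * a) \<otimes> S" by (simp add: S_upow m_assoc)
  then show ?case by (simp add: Suc m_assoc mult.assoc mult.left_commute)
qed simp

text \<open>
  Each factor of \<open>S\<^sup>*\<close> on the left and \<open>S\<close> on the right halves an even translation and kills an odd
  one. All orthogonality relations below are instances of this.
\<close>

lemma compress_upow_zero: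
  assumes "\<not> (2::int) ^ k dvd a" "k \<le> K" "k \<le> N"
  shows "adj A S [^] K \<otimes> (upow a \<otimes> S [^] N) = \<zero>"
  using assms
proof (induction k arbitrary: a K N)
  case (Suc k)
  then obtain K' N' where KN: "K = Suc K'" "N = Suc N'" by (metis Suc_le_D)
  have "adj A S [^] K \<otimes> (upow a \<otimes> S [^] N)
      = adj A S [^] K' \<otimes> ((adj A S \<otimes> (upow a \<otimes> S)) \<otimes> S [^] N')"
    unfolding KN using nat_pow_Suc2[of S N'] by (simp add: m_assoc)
  also have "\<dots> = \<zero>"
  proof (cases "even a")
    case True
    then obtain b where b: "a = 2 * b" by blast
    then have "\<not> 2 ^ k dvd b" using Suc.prems(1) by simp
    then show ?thesis using Suc.IH[of b K' N'] Suc.prems KN by (simp add: b compress_upow_even)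
  qed (simp add: compress_upow_odd)
  finally show ?case .
qed simp

section \<open>Compressions of the generated algebra are Laurent polynomials in S\<close>

inductive_set laurent where
  S_pow: "S [^] (n::nat) \<in> laurent"
| adj_S_pow: "adj A S [^] (n::nat) \<in> laurent"
| add: "\<lbrakk>x \<in> laurent; y \<in> laurent\<rbrakk> \<Longrightarrow> x \<oplus> y \<in> laurent"
| smult: "x \<in> laurent \<Longrightarrow> c \<odot> x \<in> laurent"

lemma laurent_closed: "laurent \<subseteq> carrier A"
proof
  show "x \<in> carrier A" if "x \<in> laurent" for x using that by induction auto
qed

lemma zero_in_laurent: "\<zero> \<in> laurent"
  using laurent.smult[OF laurent.S_pow[of 0], of 0] by simp

lemma adj_S_pow_S_pow_laurent: "adj A S [^] (K::nat) \<otimes> S [^] (N::nat) \<in> laurent"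
proof (cases "K \<le> N")
  case True
  then have "S [^] N = S [^] K \<otimes> S [^] (N - K)" by (simp add: nat_pow_mult)
  then show ?thesis by (simp add: cancel_left S_pow_cancel laurent.S_pow)
next
  case False
  then have "adj A S [^] K = adj A S [^] (K - N) \<otimes> adj A S [^] N" by (simp add: nat_pow_mult)
  then show ?thesis by (simp add: m_assoc S_pow_cancel laurent.adj_S_pow)
qed

text \<open>
  The two exponents and the translation are independent parameters because left multiplication by
  a generator changes them separately: \<open>U\<close> shifts \<open>a\<close>, and \<open>S\<close> or \<open>S\<^sup>*\<close> changes \<open>K\<close> together with
  \<open>a\<close>, leaving \<open>N\<close> alone.
\<close>

definition compression :: "nat \<Rightarrow> int \<Rightarrow> 'a \<Rightarrow> nat \<Rightarrow> 'a" where
  "compression K a x N = adj A S [^] K \<otimes> (upow a \<otimes> (x \<otimes> S [^] N))"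

definition eventually_laurent :: "'a set" where
  "eventually_laurent = {x \<in> carrier A. \<forall>a. \<exists>N0. \<forall>K\<ge>N0. \<forall>N\<ge>N0.
     compression K a x N \<in> laurent}"

lemma one_eventually_laurent: "\<one> \<in> eventually_laurent"
proof -
  have "\<exists>N0. \<forall>K\<ge>N0. \<forall>N\<ge>N0. compression K a \<one> N \<in> laurent" for a
  proof (cases "a = 0")
    case True
    then show ?thesis by (simp add: compression_def adj_S_pow_S_pow_laurent)
  next
    case False
    define k where "k = nat \<bar>a\<bar>"
    have "\<bar>a\<bar> = int k" by (simp add: k_def)
    also have "int k < int (2 ^ k)" by (simp only: of_nat_less_iff less_exp)
    finally have "\<not> 2 ^ k dvd a" using False zdvd_imp_le[of "2 ^ k" "\<bar>a\<bar>"] by auto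
    then have "\<forall>K\<ge>k. \<forall>N\<ge>k. compression K a \<one> N \<in> laurent"
      using zero_in_laurent by (simp add: compression_def compress_upow_zero)
    then show ?thesis by blast
  qed
  then show ?thesis by (simp add: eventually_laurent_def)
qed

text \<open>
  All four cases reduce a compression of \<open>gx\<close> to one of \<open>x\<close> with other parameters, or to zero.
  They use \<open>U\<^sup>aU = U\<^bsup>a+1\<^esup>\<close>, \<open>S\<^sup>*U\<^sup>aS = U\<^bsup>a/2\<^esup>\<close> for even \<open>a\<close> and \<open>0\<close> for odd \<open>a\<close>, and
  \<open>U\<^sup>aS\<^sup>* = S\<^sup>*U\<^bsup>2a\<^esup>\<close>.
\<close>

lemma eventually_laurent_left_mult:
  assumes "g \<in> {U, adj A U, S, adj A S}" and x: "x \<in> eventually_laurent"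
  shows "g \<otimes> x \<in> eventually_laurent"
proof -
  have xc: "x \<in> carrier A" using x by (simp add: eventually_laurent_def)
  have gc: "g \<in> carrier A" using assms by auto
  have ev: "\<exists>N0. \<forall>K\<ge>N0. \<forall>N\<ge>N0. compression K a x N \<in> laurent" for a
    using x by (simp add: eventually_laurent_def)
  have "\<exists>N0. \<forall>K\<ge>N0. \<forall>N\<ge>N0. compression K a (g \<otimes> x) N \<in> laurent" for a
  proof -
    consider "g = U" | "g = adj A U" | "g = S" | "g = adj A S" using assms by blast
    then show ?thesis
    proof cases
      case 1
      then have "compression K a (g \<otimes> x) N = compression K (a + 1) x N" for K N
        using upow_add_left[of "x \<otimes> S [^] N" a 1] xc by (simp add: compression_def m_assoc)
      then show ?thesis using ev by simp
    next
      case 2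
      then have "compression K a (g \<otimes> x) N = compression K (a - 1) x N" for K N
        using upow_add_left[of "x \<otimes> S [^] N" a "- 1"] xc
        by (simp add: compression_def m_assoc upow_minus_1)
      then show ?thesis using ev by simp
    next
      case 3
      have step: "compression (Suc K) a (g \<otimes> x) N
          = adj A S [^] K \<otimes> ((adj A S \<otimes> (upow a \<otimes> S)) \<otimes> (x \<otimes> S [^] N))" for K N
        using xc 3 by (simp add: compression_def m_assoc)
      show ?thesis
      proof (cases "even a")
        case True
        then obtain b where b: "a = 2 * b" by blast
        obtain N0 where N0: "\<forall>K\<ge>N0. \<forall>N\<ge>N0. compression K b x N \<in> laurent"
          using ev by blast
        have "compression K a (g \<otimes> x) N \<in> laurent"
          if KN: "K \<ge> Suc N0" "N \<ge> Suc N0" for K N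
        proof -
          obtain K' where K': "K = Suc K'" using KN(1) Suc_le_D by blast
          then have "compression K' b x N \<in> laurent" using N0 KN by simp
          then show ?thesis
            using step[of K' N] K' by (simp add: b compression_def compress_upow_even)
        qed
        then show ?thesis by blast
      next
        case False
        have "compression K a (g \<otimes> x) N \<in> laurent" if K: "K \<ge> 1" for K N
        proof -
          obtain K' where "K = Suc K'" using K Suc_le_D by auto
          then show ?thesis
            using step[of K' N] False xc by (simp add: compress_upow_odd zero_in_laurent)
        qed
        then show ?thesis by blast
      qed
    next
      case 4
      have step: "compression K a (g \<otimes> x) N = compression (Suc K) (2 * a) x N" for K N
      proof -
        have "compression (Suc K) (2 * a) x N
            = adj A S [^] K \<otimes> ((adj A S \<otimes> upow (2 * a)) \<otimes> (x \<otimes> S [^] N))"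
          using xc by (simp add: compression_def m_assoc)
        then show ?thesis using 4 xc by (simp add: compression_def adj_S_upow_even m_assoc)
      qed
      obtain N0 where "\<forall>K\<ge>N0. \<forall>N\<ge>N0. compression K (2 * a) x N \<in> laurent"
        using ev by blast
      then have "\<forall>K\<ge>N0. \<forall>N\<ge>N0. compression K a (g \<otimes> x) N \<in> laurent"
        by (simp add: step le_SucI)
      then show ?thesis by blast
    qed
  qed
  then show ?thesis using xc gc by (simp add: eventually_laurent_def)
qed

lemma eventually_laurent_add:
  assumes "x \<in> eventually_laurent" "y \<in> eventually_laurent"
  shows "x \<oplus> y \<in> eventually_laurent"
proof -
  have c: "x \<in> carrier A" "y \<in> carrier A" using assms by (auto simp: eventually_laurent_def)
  have "\<exists>N0. \<forall>K\<ge>N0. \<forall>N\<ge>N0. compression K a (x \<oplus> y) N \<in> laurent" for a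
  proof -
    obtain N1 N2 where
      "\<forall>K\<ge>N1. \<forall>N\<ge>N1. compression K a x N \<in> laurent"
      "\<forall>K\<ge>N2. \<forall>N\<ge>N2. compression K a y N \<in> laurent"
      using assms unfolding eventually_laurent_def by blast
    then have "\<forall>K\<ge>max N1 N2. \<forall>N\<ge>max N1 N2. compression K a (x \<oplus> y) N \<in> laurent"
      using c by (simp add: compression_def l_distr r_distr laurent.add)
    then show ?thesis by blast
  qed
  then show ?thesis using c by (simp add: eventually_laurent_def)
qed

lemma eventually_laurent_smult:
  assumes "x \<in> eventually_laurent"
  shows "c \<odot> x \<in> eventually_laurent"
proof -
  have xc: "x \<in> carrier A" using assms by (auto simp: eventually_laurent_def)
  have e: "compression K a (c \<odot> x) N = c \<odot> compression K a x N" for K a N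
    using xc by (simp add: compression_def smult_mult_left smult_mult_right)
  have "\<exists>N0. \<forall>K\<ge>N0. \<forall>N\<ge>N0. compression K a (c \<odot> x) N \<in> laurent" for a
  proof -
    obtain N0 where "\<forall>K\<ge>N0. \<forall>N\<ge>N0. compression K a x N \<in> laurent"
      using assms unfolding eventually_laurent_def by blast
    then show ?thesis unfolding e using laurent.smult by blast
  qed
  then show ?thesis using xc by (simp add: eventually_laurent_def)
qed

lemma generated_eventually_laurent: "star_algebra_generated A {U, S} \<subseteq> eventually_laurent"
proof -
  have ec: "y \<in> carrier A" if "y \<in> eventually_laurent" for y
    using that by (simp add: eventually_laurent_def)
  have sub: "star_subalgebra A (star_algebra_generated A {U, S})"
    by (rule star_subalgebra_generated) simp
  \<comment> \<open>Multipliers form an algebra; asking for both x and its adjoint makes them a *-algebra.\<close>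
  have "\<forall>y\<in>eventually_laurent. x \<otimes> y \<in> eventually_laurent \<and> adj A x \<otimes> y \<in> eventually_laurent"
    if "x \<in> star_algebra_generated A {U, S}" for x
    using that
  proof induction
    case (incl x)
    then show ?case using eventually_laurent_left_mult by auto
  next
    case one
    then show ?case using ec by simp
  next
    case (add x y)
    then have "x \<in> carrier A" "y \<in> carrier A" using sub by (auto simp: star_subalgebra_def)
    then show ?case using add ec by (simp add: adj_add l_distr eventually_laurent_add)
  next
    case (mult x y)
    then have "x \<in> carrier A" "y \<in> carrier A" using sub by (auto simp: star_subalgebra_def)
    then show ?case using mult ec by (simp add: adj_mult m_assoc)
  next
    case (smult x c)
    then have "x \<in> carrier A" using sub by (auto simp: star_subalgebra_def)
    then show ?case using smult ec
      by (simp add: adj_smult smult_mult_left eventually_laurent_smult)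
  next
    case (adj x)
    then have "x \<in> carrier A" using sub by (auto simp: star_subalgebra_def)
    then show ?case using adj by simp
  qed
  then show ?thesis
    using one_eventually_laurent sub by (fastforce simp: star_subalgebra_def)
qed

lemma compress_commuting:
  assumes x: "x \<in> carrier A" "x \<otimes> S = S \<otimes> x"
  shows "adj A S [^] (n::nat) \<otimes> (x \<otimes> S [^] n) = x"
proof (induction n)
  case (Suc n)
  have "adj A S [^] Suc n \<otimes> (x \<otimes> S [^] Suc n)
      = adj A S [^] n \<otimes> (adj A S \<otimes> ((x \<otimes> S) \<otimes> S [^] n))"
    using x(1) nat_pow_Suc2[of S n] by (simp add: m_assoc)
  also have "\<dots> = adj A S [^] n \<otimes> (x \<otimes> S [^] n)"
    using x by (simp add: m_assoc cancel_left adj_S_S)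
  finally show ?case using Suc by simp
qed (use x in simp)

text \<open>
  Compressing an approximant of \<open>x\<close> by a high power of \<open>S\<close> does not change \<open>x\<close>, does not increase
  the error, and turns the approximant into a Laurent polynomial.
\<close>

lemma commuting_in_closure_laurent:
  assumes x: "x \<in> norm_closure A (star_algebra_generated A {U, S})" and comm: "x \<otimes> S = S \<otimes> x"
  shows "x \<in> norm_closure A laurent"
proof -
  have xc: "x \<in> carrier A" using x by (simp add: norm_closure_def)
  have "\<exists>z\<in>laurent. nrm A (x \<ominus> z) < e" if e: "e > 0" for e
  proof -
    obtain y where y: "y \<in> star_algebra_generated A {U, S}" "nrm A (x \<ominus> y) < e"
      using x e by (auto simp: norm_closure_def)
    then have ye: "y \<in> eventually_laurent" using generated_eventually_laurent by blast
    then have yc: "y \<in> carrier A" by (simp add: eventually_laurent_def)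
    obtain N where "compression N 0 y N \<in> laurent"
      using ye unfolding eventually_laurent_def by blast
    then have z: "adj A S [^] N \<otimes> (y \<otimes> S [^] N) \<in> laurent"
      using yc by (simp add: compression_def)
    have "x \<ominus> adj A S [^] N \<otimes> (y \<otimes> S [^] N) = adj A S [^] N \<otimes> ((x \<ominus> y) \<otimes> S [^] N)"
      using xc yc compress_commuting[OF xc comm] by (simp add: diff_mult_left diff_mult_right)
    also have "nrm A \<dots> \<le> nrm A ((x \<ominus> y) \<otimes> S [^] N)"
      using xc yc by (intro nrm_mult_le_left nrm_adj_S_pow) auto
    also have "\<dots> \<le> nrm A (x \<ominus> y)"
      using xc yc by (intro nrm_mult_le_right nrm_S_pow) auto
    finally show ?thesis using y z by (intro bexI[of _ "adj A S [^] N \<otimes> (y \<otimes> S [^] N)"]) auto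
  qed
  then show ?thesis using xc by (simp add: norm_closure_def)
qed

section \<open>The constant term seen by the defect projection\<close>

definition defect :: 'a where
  "defect = \<one> \<ominus> S \<otimes> adj A S"

lemma defect_closed [simp, intro]: "defect \<in> carrier A"
  by (simp add: defect_def)

lemma defect_S: "defect \<otimes> S = \<zero>"
  by (simp add: defect_def diff_mult_left m_assoc adj_S_S)

lemma adj_S_defect: "adj A S \<otimes> defect = \<zero>"
  by (simp add: defect_def diff_mult_right cancel_left adj_S_S)

lemma defect_idem: "defect \<otimes> defect = defect"
proof -
  have "defect \<otimes> defect = defect \<otimes> \<one> \<ominus> defect \<otimes> (S \<otimes> adj A S)"
    by (subst (2) defect_def, subst diff_mult_right) auto
  also have "defect \<otimes> (S \<otimes> adj A S) = \<zero>"
    by (simp flip: m_assoc add: defect_S)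
  finally show ?thesis by (simp add: a_minus_def)
qed

lemma adj_defect: "adj A defect = defect"
  by (simp add: defect_def adj_diff adj_mult)

lemma nrm_defect: "nrm A defect \<le> 1"
proof -
  have "nrm A defect = (nrm A defect)\<^sup>2"
    using cstar_identity[of defect] by (simp add: adj_defect defect_idem)
  then show ?thesis by (auto simp: power2_eq_square)
qed

text \<open>
  Positive powers of \<open>S\<close> are killed by \<open>pS = 0\<close> and positive powers of \<open>S\<^sup>*\<close> by \<open>S\<^sup>*p = 0\<close>, so \<open>c\<close> is
  the constant term of \<open>y\<close>.
\<close>

lemma defect_laurent_defect:
  "y \<in> laurent \<Longrightarrow> \<exists>c. defect \<otimes> (y \<otimes> defect) = c \<odot> defect"
proof (induction rule: laurent.induct)
  case (S_pow n)
  show ?case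
  proof (cases n)
    case 0
    then show ?thesis by (intro exI[of _ 1]) (simp add: defect_idem)
  next
    case (Suc m)
    have "defect \<otimes> (S [^] n \<otimes> defect) = (defect \<otimes> S) \<otimes> (S [^] m \<otimes> defect)"
      using nat_pow_Suc2[of S m] by (simp add: Suc m_assoc)
    then show ?thesis by (intro exI[of _ 0]) (simp add: defect_S)
  qed
next
  case (adj_S_pow n)
  show ?case
  proof (cases n)
    case 0
    then show ?thesis by (intro exI[of _ 1]) (simp add: defect_idem)
  next
    case (Suc m)
    then show ?thesis by (intro exI[of _ 0]) (simp add: m_assoc adj_S_defect)
  qed
next
  case (add x y)
  then obtain a b where "defect \<otimes> (x \<otimes> defect) = a \<odot> defect" "defect \<otimes> (y \<otimes> defect) = b \<odot> defect"
    by blast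
  moreover have "x \<in> carrier A" "y \<in> carrier A" using add laurent_closed by auto
  ultimately show ?case by (intro exI[of _ "a + b"]) (simp add: l_distr r_distr smult_add)
next
  case (smult x c)
  then obtain a where "defect \<otimes> (x \<otimes> defect) = a \<odot> defect" by blast
  moreover have "x \<in> carrier A" using smult laurent_closed by auto
  ultimately show ?case
    by (intro exI[of _ "c * a"]) (simp add: smult_mult_left smult_mult_right smult_smult)
qed

text \<open>
  Since \<open>x\<close> commutes with \<open>p\<close>, the product \<open>xp\<close> is the compression \<open>pxp\<close>, hence a limit of
  compressions of Laurent polynomials, which are multiples of \<open>p\<close>.
\<close>

lemma commuting_mult_defect:
  assumes x: "x \<in> norm_closure A laurent"
    and comm: "x \<otimes> S = S \<otimes> x" "x \<otimes> adj A S = adj A S \<otimes> x"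
  shows "\<exists>c. x \<otimes> defect = c \<odot> defect"
proof (rule scalar_multiples_closed)
  have xc: "x \<in> carrier A" using x by (simp add: norm_closure_def)
  then show "x \<otimes> defect \<in> carrier A" by simp
  have "x \<otimes> (S \<otimes> adj A S) = S \<otimes> adj A S \<otimes> x"
    using xc comm by (simp add: m_assoc flip: m_assoc[of x S])
  then have "x \<otimes> defect = defect \<otimes> x"
    using xc by (simp add: defect_def diff_mult_left diff_mult_right)
  then have xd: "defect \<otimes> (x \<otimes> defect) = x \<otimes> defect"
    using xc by (simp add: defect_idem flip: m_assoc)
  fix e :: real assume "e > 0"
  then obtain y where y: "y \<in> laurent" "nrm A (x \<ominus> y) < e"
    using x by (auto simp: norm_closure_def)
  then have yc: "y \<in> carrier A" using laurent_closed by blast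
  obtain c where c: "defect \<otimes> (y \<otimes> defect) = c \<odot> defect"
    using defect_laurent_defect y by blast
  have "x \<otimes> defect \<ominus> c \<odot> defect = defect \<otimes> ((x \<ominus> y) \<otimes> defect)"
    using xc yc by (simp add: diff_mult_left diff_mult_right xd c)
  also have "nrm A \<dots> \<le> nrm A ((x \<ominus> y) \<otimes> defect)"
    using xc yc by (intro nrm_mult_le_left nrm_defect) auto
  also have "\<dots> \<le> nrm A (x \<ominus> y)"
    using xc yc by (intro nrm_mult_le_right nrm_defect) auto
  finally show "\<exists>c. nrm A (x \<otimes> defect \<ominus> c \<odot> defect) < e"
    using y by (intro exI[of _ c]) simp
qed simp

section \<open>Ladder sums almost commute with S\<close>

text \<open>
  \<open>ladder M i\<close> is the map \<open>e\<^sub>k \<mapsto> e\<^sub>m\<close> with \<open>m = 2\<^sup>M k + 2\<^sup>i\<close>. For \<open>i < M\<close> its range avoids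
  \<open>e\<^sub>0\<close>, and different \<open>i\<close> give different residues modulo \<open>2\<^sup>M\<close>.
\<close>

definition ladder :: "nat \<Rightarrow> nat \<Rightarrow> 'a" where
  "ladder M i = upow (2 ^ i) \<otimes> S [^] M"

primrec ladder_sum :: "nat \<Rightarrow> nat \<Rightarrow> 'a" where
  "ladder_sum M 0 = \<zero>"
| "ladder_sum M (Suc n) = ladder_sum M n \<oplus> ladder M n"

lemma ladder_closed [simp, intro]: "ladder M i \<in> carrier A"
  by (simp add: ladder_def)

lemma ladder_sum_closed [simp, intro]: "ladder_sum M n \<in> carrier A"
  by (induction n) auto

lemma adj_ladder_ladder:
  "adj A (ladder M i) \<otimes> ladder M j = adj A S [^] M \<otimes> (upow (2 ^ j - 2 ^ i) \<otimes> S [^] M)"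
  by (simp add: ladder_def adj_mult adj_upow adj_pow m_assoc upow_add_left)

lemma ladder_isometry: "adj A (ladder M i) \<otimes> ladder M i = \<one>"
  by (simp add: adj_ladder_ladder S_pow_cancel)

lemma ladder_orthogonal:
  assumes "i < M" "j < M" "i \<noteq> j"
  shows "adj A (ladder M i) \<otimes> ladder M j = \<zero>"
proof -
  have "(2::int) ^ i < 2 ^ M" "(2::int) ^ j < 2 ^ M" "(2::int) ^ i \<noteq> 2 ^ j"
    using assms by simp_all
  moreover have "(2::int) ^ i > 0" "(2::int) ^ j > 0" by simp_all
  ultimately have "\<bar>2 ^ j - 2 ^ i :: int\<bar> < 2 ^ M" "2 ^ j - 2 ^ i \<noteq> (0::int)" by linarith+
  then have "\<not> (2::int) ^ M dvd 2 ^ j - 2 ^ i"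
    using zdvd_imp_le[of "2 ^ M" "\<bar>2 ^ j - 2 ^ i\<bar>"] by auto
  then show ?thesis by (simp add: adj_ladder_ladder compress_upow_zero)
qed

lemma adj_ladder_ladder_sum: "\<lbrakk>n \<le> i; i < M\<rbrakk> \<Longrightarrow> adj A (ladder M i) \<otimes> ladder_sum M n = \<zero>"
  by (induction n) (simp_all add: r_distr ladder_orthogonal)

lemma ladder_sum_square: "n \<le> M \<Longrightarrow> adj A (ladder_sum M n) \<otimes> ladder_sum M n = of_nat n \<odot> \<one>"
proof (induction n)
  case (Suc n)
  have 1: "adj A (ladder M n) \<otimes> ladder_sum M n = \<zero>"
    using Suc.prems by (simp add: adj_ladder_ladder_sum)
  have "adj A (adj A (ladder M n) \<otimes> ladder_sum M n) = \<zero>" by (simp add: 1)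
  then have 2: "adj A (ladder_sum M n) \<otimes> ladder M n = \<zero>" by (simp add: adj_mult)
  show ?case
    using Suc by (simp add: adj_add l_distr r_distr 1 2 ladder_isometry smult_add a_comm)
qed simp

lemma nrm_ladder: "nrm A (ladder M i) \<le> 1"
  by (rule nrm_isometry_le) (simp_all add: ladder_isometry)

lemma nrm_ladder_sum: "nrm A (ladder_sum n n) \<le> sqrt (real n)"
proof (rule real_le_rsqrt)
  have "(nrm A (ladder_sum n n))\<^sup>2 = real n * nrm A \<one>"
    by (simp add: cstar_identity[symmetric] ladder_sum_square nrm_smult)
  then show "(nrm A (ladder_sum n n))\<^sup>2 \<le> real n"
    using nrm_one_le mult_left_mono[of "nrm A \<one>" 1 "real n"] by simp
qed

lemma S_ladder: "S \<otimes> ladder M i = ladder M (Suc i) \<otimes> S"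
proof -
  have "S \<otimes> ladder M i = (S \<otimes> upow (2 ^ i)) \<otimes> S [^] M" by (simp add: ladder_def m_assoc)
  also have "\<dots> = upow (2 ^ Suc i) \<otimes> S [^] Suc M"
    using nat_pow_Suc2[of S M] by (simp add: S_upow m_assoc)
  finally show ?thesis by (simp add: ladder_def m_assoc)
qed

text \<open>
  Multiplication by \<open>S\<close> shifts the ladder by one rung, so all but the first and the last rung
  cancel. The identity is written with the boundary terms on opposite sides to avoid subtraction.
\<close>

lemma S_ladder_sum:
  "S \<otimes> ladder_sum M n \<oplus> ladder M 0 \<otimes> S = ladder_sum M n \<otimes> S \<oplus> ladder M n \<otimes> S"
proof (induction n)
  case (Suc n)
  have "S \<otimes> ladder_sum M (Suc n) \<oplus> ladder M 0 \<otimes> S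
      = (S \<otimes> ladder_sum M n \<oplus> ladder M 0 \<otimes> S) \<oplus> ladder M (Suc n) \<otimes> S"
    by (simp add: r_distr S_ladder a_assoc a_comm a_lcomm)
  then show ?case by (simp add: Suc l_distr)
qed simp

lemma nrm_commutator_S_ladder_sum: "nrm A (S \<otimes> ladder_sum M n \<ominus> ladder_sum M n \<otimes> S) \<le> 2"
proof -
  let ?x = "S \<otimes> ladder_sum M n" and ?y = "ladder_sum M n \<otimes> S"
  let ?a = "ladder M 0 \<otimes> S" and ?b = "ladder M n \<otimes> S"
  have le: "nrm A (ladder M i \<otimes> S) \<le> 1" for i
    using nrm_mult_le_right[of "ladder M i" S] nrm_S nrm_ladder[of M i] by simp
  have "?x \<ominus> ?y = (?x \<oplus> ?a) \<ominus> (?y \<oplus> ?a)"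
    by (subst add_diff_add) simp_all
  also have "\<dots> = (?y \<oplus> ?b) \<ominus> (?y \<oplus> ?a)" by (simp only: S_ladder_sum)
  also have "\<dots> = ?b \<oplus> \<ominus> ?a"
    by (subst add_diff_add) (simp_all add: a_minus_def r_neg)
  also have "nrm A \<dots> \<le> nrm A ?b + nrm A (\<ominus> ?a)" by (rule nrm_triangle) auto
  also have "\<dots> \<le> 2" using le[of n] le[of 0] by (simp add: nrm_uminus)
  finally show ?thesis .
qed

text \<open>
  The bound must not depend on \<open>n\<close>: compared with the norm \<open>\<surd>n\<close> of the ladder sum it becomes
  negligible.
\<close>

definition bounded_commutators :: "'a set" where
  "bounded_commutators = {q \<in> carrier A. \<exists>C. \<forall>n.
     nrm A (q \<otimes> ladder_sum n n \<ominus> ladder_sum n n \<otimes> q) \<le> C}"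

lemma S_pow_bounded_commutators: "S [^] (j::nat) \<in> bounded_commutators"
proof (induction j)
  case 0
  show ?case by (auto simp: bounded_commutators_def)
next
  case (Suc j)
  then obtain C where C: "\<And>n. nrm A (S [^] j \<otimes> ladder_sum n n \<ominus> ladder_sum n n \<otimes> S [^] j) \<le> C"
    by (auto simp: bounded_commutators_def)
  have "nrm A (S [^] Suc j \<otimes> ladder_sum n n \<ominus> ladder_sum n n \<otimes> S [^] Suc j) \<le> 2 + C" for n
  proof -
    let ?W = "ladder_sum n n" and ?q = "S [^] j"
    have "nrm A (?q \<otimes> (S \<otimes> ?W) \<ominus> ?W \<otimes> (?q \<otimes> S))
        \<le> nrm A (?q \<otimes> (S \<otimes> ?W) \<ominus> ?q \<otimes> (?W \<otimes> S)) + nrm A (?q \<otimes> (?W \<otimes> S) \<ominus> ?W \<otimes> (?q \<otimes> S))"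
      by (rule nrm_diff_triangle) auto
    also have "?q \<otimes> (S \<otimes> ?W) \<ominus> ?q \<otimes> (?W \<otimes> S) = ?q \<otimes> (S \<otimes> ?W \<ominus> ?W \<otimes> S)"
      by (simp add: diff_mult_right)
    also have "?q \<otimes> (?W \<otimes> S) \<ominus> ?W \<otimes> (?q \<otimes> S) = (?q \<otimes> ?W \<ominus> ?W \<otimes> ?q) \<otimes> S"
      by (simp add: diff_mult_left m_assoc)
    also have "nrm A (?q \<otimes> (S \<otimes> ?W \<ominus> ?W \<otimes> S)) \<le> nrm A (S \<otimes> ?W \<ominus> ?W \<otimes> S)"
      by (intro nrm_mult_le_left nrm_S_pow) auto
    also have "\<dots> \<le> 2" by (rule nrm_commutator_S_ladder_sum)
    also have "nrm A ((?q \<otimes> ?W \<ominus> ?W \<otimes> ?q) \<otimes> S) \<le> nrm A (?q \<otimes> ?W \<ominus> ?W \<otimes> ?q)"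
      by (intro nrm_mult_le_right nrm_S) auto
    also have "\<dots> \<le> C" by (rule C)
    finally show ?thesis by (simp add: m_assoc)
  qed
  then show ?case by (auto simp: bounded_commutators_def)
qed

lemma bounded_commutators_add:
  assumes "x \<in> bounded_commutators" "y \<in> bounded_commutators"
  shows "x \<oplus> y \<in> bounded_commutators"
proof -
  obtain C D where CD:
    "\<And>n. nrm A (x \<otimes> ladder_sum n n \<ominus> ladder_sum n n \<otimes> x) \<le> C"
    "\<And>n. nrm A (y \<otimes> ladder_sum n n \<ominus> ladder_sum n n \<otimes> y) \<le> D"
    using assms by (auto simp: bounded_commutators_def)
  have c: "x \<in> carrier A" "y \<in> carrier A" using assms by (auto simp: bounded_commutators_def)
  have "nrm A ((x \<oplus> y) \<otimes> ladder_sum n n \<ominus> ladder_sum n n \<otimes> (x \<oplus> y)) \<le> C + D" for n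
  proof -
    let ?cx = "x \<otimes> ladder_sum n n \<ominus> ladder_sum n n \<otimes> x"
    let ?cy = "y \<otimes> ladder_sum n n \<ominus> ladder_sum n n \<otimes> y"
    have eq: "(x \<oplus> y) \<otimes> ladder_sum n n \<ominus> ladder_sum n n \<otimes> (x \<oplus> y) = ?cx \<oplus> ?cy"
      using c by (simp add: l_distr r_distr add_diff_add)
    have "nrm A (?cx \<oplus> ?cy) \<le> nrm A ?cx + nrm A ?cy"
      by (rule nrm_triangle) (use c in simp_all)
    then show ?thesis unfolding eq using CD(1)[of n] CD(2)[of n] by linarith
  qed
  then show ?thesis using c by (auto simp: bounded_commutators_def)
qed

lemma bounded_commutators_smult:
  assumes "x \<in> bounded_commutators"
  shows "c \<odot> x \<in> bounded_commutators"
proof -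
  obtain C where C: "\<And>n. nrm A (x \<otimes> ladder_sum n n \<ominus> ladder_sum n n \<otimes> x) \<le> C"
    using assms by (auto simp: bounded_commutators_def)
  have xc: "x \<in> carrier A" using assms by (auto simp: bounded_commutators_def)
  have "nrm A (c \<odot> x \<otimes> ladder_sum n n \<ominus> ladder_sum n n \<otimes> (c \<odot> x)) \<le> cmod c * C" for n
    using xc C[of n]
    by (simp add: smult_mult_left smult_mult_right nrm_smult mult_left_mono flip: smult_diff_right)
  then show ?thesis using xc by (auto simp: bounded_commutators_def)
qed

text \<open>
  The commutators of \<open>S\<^sup>*\<close> with the ladder sums are not controlled. Multiplying by a high power of
  \<open>S\<close> turns a Laurent polynomial into a polynomial in \<open>S\<close>.
\<close>

lemma laurent_S_pow_bounded_commutators: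
  "y \<in> laurent \<Longrightarrow> \<exists>D0. \<forall>D\<ge>D0. y \<otimes> S [^] (D::nat) \<in> bounded_commutators"
proof (induction rule: laurent.induct)
  case (S_pow n)
  then show ?case by (simp add: nat_pow_mult S_pow_bounded_commutators)
next
  case (adj_S_pow n)
  have "adj A S [^] n \<otimes> S [^] D \<in> bounded_commutators" if "D \<ge> n" for D
  proof -
    have "S [^] D = S [^] n \<otimes> S [^] (D - n)" using that by (simp add: nat_pow_mult)
    then show ?thesis by (simp add: cancel_left S_pow_cancel S_pow_bounded_commutators)
  qed
  then show ?case by blast
next
  case (add x y)
  then obtain D1 D2 where
    "\<forall>D\<ge>D1. x \<otimes> S [^] (D::nat) \<in> bounded_commutators"
    "\<forall>D\<ge>D2. y \<otimes> S [^] (D::nat) \<in> bounded_commutators"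
    by blast
  moreover have "x \<in> carrier A" "y \<in> carrier A" using add laurent_closed by auto
  ultimately have "\<forall>D\<ge>max D1 D2. (x \<oplus> y) \<otimes> S [^] D \<in> bounded_commutators"
    by (simp add: l_distr bounded_commutators_add)
  then show ?case by blast
next
  case (smult x c)
  then obtain D1 where "\<forall>D\<ge>D1. x \<otimes> S [^] (D::nat) \<in> bounded_commutators" by blast
  moreover have "x \<in> carrier A" using smult laurent_closed by auto
  ultimately have "\<forall>D\<ge>D1. (c \<odot> x) \<otimes> S [^] D \<in> bounded_commutators"
    by (simp add: smult_mult_left bounded_commutators_smult)
  then show ?case by blast
qed

text \<open>
  The ladder sum \<open>W\<close> is \<open>\<surd>n\<close> times an isometry, so \<open>\<parallel>Wq\<parallel> = \<surd>n\<parallel>q\<parallel>\<close>, and replacing \<open>Wq\<close> by \<open>qW\<close>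
  costs only a constant. Thus \<open>\<surd>n (\<parallel>q\<parallel> - e)\<close> stays bounded as \<open>n\<close> grows.
\<close>

lemma nrm_le_if_small_on_ladder:
  assumes q: "q \<in> bounded_commutators"
    and small: "\<And>n. nrm A (q \<otimes> ladder_sum n n) \<le> e * sqrt (real n)"
  shows "nrm A q \<le> e"
proof (rule ccontr)
  assume "\<not> nrm A q \<le> e"
  then have d: "nrm A q - e > 0" by simp
  have qc: "q \<in> carrier A" using q by (simp add: bounded_commutators_def)
  obtain C where C: "\<And>n. nrm A (q \<otimes> ladder_sum n n \<ominus> ladder_sum n n \<otimes> q) \<le> C"
    using q by (auto simp: bounded_commutators_def)
  have bound: "sqrt (real n) * (nrm A q - e) \<le> C" if n: "n > 0" for n
  proof -
    let ?W = "ladder_sum n n"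
    have "?W \<otimes> q \<in> carrier A" using qc by simp
    have "real n * nrm A q = nrm A (of_nat n \<odot> q)" using qc by (simp add: nrm_smult)
    also have "of_nat n \<odot> q = adj A ?W \<otimes> (?W \<otimes> q)"
      using qc ladder_sum_square[of n n]
      by (simp flip: m_assoc) (simp add: smult_mult_left)
    also have "nrm A \<dots> \<le> nrm A (adj A ?W) * nrm A (?W \<otimes> q)"
      using qc by (intro nrm_mult) auto
    also have "\<dots> \<le> sqrt (real n) * nrm A (?W \<otimes> q)"
      using qc nrm_ladder_sum[of n] by (intro mult_right_mono nrm_nonneg) (auto simp: nrm_adj)
    also have "\<dots> \<le> sqrt (real n) * (C + e * sqrt (real n))"
    proof (rule mult_left_mono)
      have "nrm A (?W \<otimes> q) \<le> nrm A (?W \<otimes> q \<ominus> q \<otimes> ?W) + nrm A (q \<otimes> ?W)"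
        using qc by (intro nrm_triangle_diff) auto
      then show "nrm A (?W \<otimes> q) \<le> C + e * sqrt (real n)"
        using C[of n] small[of n] qc nrm_diff_commute[of "q \<otimes> ?W" "?W \<otimes> q"] by simp
    qed simp
    finally have "sqrt (real n) * (sqrt (real n) * nrm A q) \<le> sqrt (real n) * (C + e * sqrt (real n))"
      by (simp flip: mult.assoc)
    then have "sqrt (real n) * nrm A q \<le> C + e * sqrt (real n)"
      using n by (subst (asm) mult_le_cancel_left_pos) auto
    then show ?thesis by (simp add: algebra_simps)
  qed
  obtain n :: nat where n: "(C / (nrm A q - e))\<^sup>2 < real n" using reals_Archimedean2 by blast
  then have n0: "n > 0" by (metis of_nat_0_less_iff order.strict_trans1 zero_le_power2)
  have "C / (nrm A q - e) < sqrt (real n)" using n by (rule real_less_rsqrt)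
  then have "C < sqrt (real n) * (nrm A q - e)" using d by (simp add: pos_divide_less_eq)
  then show False using bound[OF n0] by linarith
qed

section \<open>The relative commutant of S\<close>

text \<open>
  From \<open>up = 0\<close> it follows that \<open>u = u S\<^sup>nS\<^sup>*\<^sup>n\<close> for all \<open>n\<close>, and for large \<open>n\<close> the range of \<open>S\<^sup>n\<close> is
  orthogonal to that of \<open>S\<^sup>D\<close> times a ladder sum. An approximant \<open>y S\<^sup>D\<close> of \<open>u S\<^sup>D\<close> is therefore
  small on the ladder sums, hence small.
\<close>

lemma commuting_annihilating_defect_zero:
  assumes u: "u \<in> norm_closure A laurent"
    and comm: "u \<otimes> S = S \<otimes> u"
    and ann: "u \<otimes> defect = \<zero>"
  shows "u = \<zero>"
proof -
  have uc: "u \<in> carrier A" using u by (simp add: norm_closure_def)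
  have uSS: "u \<otimes> (S \<otimes> adj A S) = u"
    using eq_if_diff_zero[of u "u \<otimes> (S \<otimes> adj A S)"] ann uc
    by (simp add: defect_def diff_mult_right)
  have u_range: "u \<otimes> (S [^] n \<otimes> adj A S [^] n) = u" for n :: nat
  proof (induction n)
    case (Suc n)
    have "u \<otimes> (S [^] Suc n \<otimes> adj A S [^] Suc n)
        = (u \<otimes> S) \<otimes> (S [^] n \<otimes> (adj A S [^] n \<otimes> adj A S))"
      using uc nat_pow_Suc2[of S n] by (simp add: m_assoc)
    also have "\<dots> = S \<otimes> (u \<otimes> (S [^] n \<otimes> adj A S [^] n)) \<otimes> adj A S"
      using uc by (simp add: comm m_assoc)
    also have "\<dots> = (u \<otimes> S) \<otimes> adj A S" using Suc by (simp add: comm)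
    finally show ?case using uc uSS by (simp add: m_assoc)
  qed (use uc in simp)
  \<comment> \<open>The translation \<open>2 ^ i\<close> of the \<open>i\<close>-th rung, doubled \<open>D\<close> times, is not divisible by
    \<open>2 ^ (D + M)\<close>, so it moves the range of \<open>S [^] (D + M)\<close> to an orthogonal one.\<close>
  have kill: "u \<otimes> (S [^] D \<otimes> ladder M i) = \<zero>" if "i < M" for D M i :: nat
  proof -
    have nd: "\<not> (2::int) ^ (D + M) dvd 2 ^ (D + i)"
      using that zdvd_imp_le[of "2 ^ (D + M)" "2 ^ (D + i)"] by auto
    have "S [^] D \<otimes> ladder M i = (S [^] D \<otimes> upow (2 ^ i)) \<otimes> S [^] M"
      by (simp add: ladder_def m_assoc)
    also have "\<dots> = upow (2 ^ (D + i)) \<otimes> S [^] (D + M)"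
      by (simp add: S_pow_upow m_assoc nat_pow_mult power_add)
    finally have "u \<otimes> (S [^] D \<otimes> ladder M i)
        = u \<otimes> (S [^] (D + M) \<otimes> adj A S [^] (D + M)) \<otimes> (upow (2 ^ (D + i)) \<otimes> S [^] (D + M))"
      by (simp only: u_range)
    also have "\<dots> = u \<otimes> (S [^] (D + M)
        \<otimes> (adj A S [^] (D + M) \<otimes> (upow (2 ^ (D + i)) \<otimes> S [^] (D + M))))"
      using uc by (simp add: m_assoc)
    also have "\<dots> = \<zero>" using uc compress_upow_zero[OF nd, of "D + M" "D + M"] by simp
    finally show ?thesis .
  qed
  have kill_sum: "u \<otimes> (S [^] D \<otimes> ladder_sum M n) = \<zero>" if "n \<le> M" for D M n :: nat
    using that by (induction n) (simp_all add: uc r_distr kill)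
  have "nrm A u \<le> e" if e: "e > 0" for e
  proof -
    obtain y where y: "y \<in> laurent" "nrm A (u \<ominus> y) < e / 2"
      using u e half_gt_zero unfolding norm_closure_def by blast
    then have yc: "y \<in> carrier A" using laurent_closed by blast
    obtain D :: nat where D: "y \<otimes> S [^] D \<in> bounded_commutators"
      using laurent_S_pow_bounded_commutators[OF y(1)] by blast
    have q: "nrm A (y \<otimes> S [^] D) \<le> e / 2"
    proof (rule nrm_le_if_small_on_ladder[OF D])
      fix n
      let ?W = "ladder_sum n n"
      have "nrm A (y \<otimes> S [^] D \<otimes> ?W) = nrm A (u \<otimes> S [^] D \<otimes> ?W \<ominus> y \<otimes> S [^] D \<otimes> ?W)"
        using uc yc kill_sum[of n n D] by (simp add: m_assoc a_minus_def nrm_uminus)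
      also have "u \<otimes> S [^] D \<otimes> ?W \<ominus> y \<otimes> S [^] D \<otimes> ?W = ((u \<ominus> y) \<otimes> S [^] D) \<otimes> ?W"
        using uc yc by (simp add: diff_mult_left)
      also have "nrm A \<dots> \<le> nrm A ((u \<ominus> y) \<otimes> S [^] D) * nrm A ?W"
        using uc yc by (intro nrm_mult) auto
      also have "\<dots> \<le> e / 2 * sqrt (real n)"
      proof (intro mult_mono nrm_ladder_sum nrm_nonneg)
        show "nrm A ((u \<ominus> y) \<otimes> S [^] D) \<le> e / 2"
          using nrm_mult_le_right[of "u \<ominus> y" "S [^] D"] nrm_S_pow[of D] y uc yc by simp
      qed (use e in auto)
      finally show "nrm A (y \<otimes> S [^] D \<otimes> ?W) \<le> e / 2 * sqrt (real n)" .
    qed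
    have "nrm A u = nrm A (adj A S [^] D \<otimes> (u \<otimes> S [^] D))"
      using compress_commuting[OF uc comm] by simp
    also have "\<dots> \<le> nrm A (u \<otimes> S [^] D)"
      using uc by (intro nrm_mult_le_left nrm_adj_S_pow) auto
    also have "\<dots> \<le> nrm A (u \<otimes> S [^] D \<ominus> y \<otimes> S [^] D) + nrm A (y \<otimes> S [^] D)"
      using uc yc by (intro nrm_triangle_diff) auto
    also have "u \<otimes> S [^] D \<ominus> y \<otimes> S [^] D = (u \<ominus> y) \<otimes> S [^] D"
      using uc yc by (simp add: diff_mult_left)
    also have "nrm A ((u \<ominus> y) \<otimes> S [^] D) \<le> nrm A (u \<ominus> y)"
      using uc yc by (intro nrm_mult_le_right nrm_S_pow) auto
    finally show ?thesis using y q by linarith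
  qed
  then show ?thesis using zero_if_nrm_small uc by blast
qed

theorem relative_commutant_trivial:
  assumes x: "x \<in> norm_closure A (star_algebra_generated A {U, S})"
    and comm: "x \<otimes> S = S \<otimes> x" "x \<otimes> adj A S = adj A S \<otimes> x"
  shows "\<exists>c. x = c \<odot> \<one>"
proof -
  have xL: "x \<in> norm_closure A laurent"
    by (rule commuting_in_closure_laurent[OF x comm(1)])
  then have xc: "x \<in> carrier A" by (simp add: norm_closure_def)
  obtain c where c: "x \<otimes> defect = c \<odot> defect"
    using commuting_mult_defect[OF xL comm] by blast
  let ?u = "x \<ominus> c \<odot> \<one>"
  have "\<exists>z\<in>laurent. nrm A (?u \<ominus> z) < e" if e: "e > 0" for e
  proof -
    obtain y where y: "y \<in> laurent" "nrm A (x \<ominus> y) < e"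
      using xL e by (auto simp: norm_closure_def)
    have yc: "y \<in> carrier A" using y laurent_closed by blast
    have "?u = x \<oplus> (- c) \<odot> \<one>"
      using xc by (simp add: a_minus_def minus_eq_smult smult_smult)
    then have "?u \<ominus> (y \<oplus> (- c) \<odot> \<one>) = (x \<ominus> y) \<oplus> ((- c) \<odot> \<one> \<ominus> (- c) \<odot> \<one>)"
      using xc yc by (simp only:) (rule add_diff_add, auto)
    then have "?u \<ominus> (y \<oplus> (- c) \<odot> \<one>) = x \<ominus> y" using xc yc by simp
    moreover have "(- c) \<odot> \<one> \<in> laurent"
      using laurent.smult[OF laurent.S_pow[of 0]] by simp
    ultimately show ?thesis
      using y by (intro bexI[of _ "y \<oplus> (- c) \<odot> \<one>"]) (auto intro: laurent.add)
  qed
  then have "?u \<in> norm_closure A laurent" using xc by (simp add: norm_closure_def)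
  moreover have "?u \<otimes> S = S \<otimes> ?u"
    using xc comm by (simp add: diff_mult_left diff_mult_right smult_mult_left smult_mult_right)
  moreover have "?u \<otimes> defect = \<zero>"
    using xc c by (simp add: diff_mult_left smult_mult_left)
  ultimately have "?u = \<zero>" by (rule commuting_annihilating_defect_zero)
  then show ?thesis using xc eq_if_diff_zero by blast
qed

end

section \<open>Consequences of the universal property\<close>

text \<open>
  The closure \<open>B\<close> of \<open>X\<close> is itself a C*-algebra with a pair satisfying the relations. The induced
  homomorphism into \<open>B\<close>, regarded as an endomorphism of \<open>Q\<close>, fixes the generators, and so does the
  identity. By uniqueness they agree, hence every element of \<open>Q\<close> lies in \<open>B\<close>.
\<close>

lemma two_adic_norm_closure:
  assumes Q: "is_two_adic_ring_cstar Q U S2"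
    and X: "star_subalgebra Q X" "U \<in> X" "S2 \<in> X"
  shows "norm_closure Q X = carrier Q"
proof
  show "norm_closure Q X \<subseteq> carrier Q" by (auto simp: norm_closure_def)
  interpret cstar_algebra Q using Q by (simp add: is_two_adic_ring_cstar_def)
  let ?B = "Q\<lparr>carrier := norm_closure Q X\<rparr>"
  have rel: "two_adic_relations Q U S2" using Q by (simp add: is_two_adic_ring_cstar_def)
  have XQ: "X \<subseteq> carrier Q" using X by (simp add: star_subalgebra_def)
  have "U \<in> norm_closure Q X" "S2 \<in> norm_closure Q X"
    using X subset_norm_closure[OF XQ] by auto
  then have "two_adic_relations ?B U S2"
    using rel by (simp add: two_adic_relations_def cstar_unitary_def cstar_isometry_def
        numeral_2_eq_2 nat_pow_def)
  then obtain h where h: "h \<in> cstar_hom Q ?B" "h U = U" "h S2 = S2"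
    using Q cstar_algebra_norm_closure[OF X(1)] unfolding is_two_adic_ring_cstar_def by blast
  then have hQ: "h \<in> cstar_hom Q Q"
    by (auto simp: cstar_hom_def ring_hom_def norm_closure_def)
  have idQ: "(\<lambda>x. x) \<in> cstar_hom Q Q"
    by (auto simp: cstar_hom_def ring_hom_def)
  obtain k where "\<And>g. \<lbrakk>g \<in> cstar_hom Q Q; g U = U; g S2 = S2\<rbrakk> \<Longrightarrow> \<forall>x\<in>carrier Q. g x = k x"
    using Q rel cstar_algebra_axioms unfolding is_two_adic_ring_cstar_def by blast
  then have "\<forall>x\<in>carrier Q. h x = x"
    using hQ idQ h by metis
  moreover have "h x \<in> norm_closure Q X" if "x \<in> carrier Q" for x
    using h(1) that by (auto simp: cstar_hom_def ring_hom_def)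
  ultimately show "carrier Q \<subseteq> norm_closure Q X" by force
qed

text \<open>
  The relation \<open>S\<^sub>1\<^sup>*US\<^sub>1 = 0\<close> amounts to \<open>S\<^sub>2\<^sup>*US\<^sub>2 = 0\<close>, orthogonality of the ranges of \<open>S\<^sub>2\<close> and
  \<open>US\<^sub>2\<close>. It comes from the sum relation: two projections with sum 1 are orthogonal, which shows
  up as \<open>z = z + z\<close> for \<open>z = S\<^sub>2\<^sup>*US\<^sub>2\<close> after multiplying the sum relation by \<open>S\<^sub>2\<^sup>*\<close> and \<open>US\<^sub>2\<close>.
\<close>

lemma (in cstar_algebra) two_adic_doubling_pair:
  assumes "two_adic_relations A U S2"
  shows "doubling_pair A U (U \<otimes> S2)"
proof -
  have c [simp]: "U \<in> carrier A" "S2 \<in> carrier A"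
    and UU: "adj A U \<otimes> U = \<one>" "U \<otimes> adj A U = \<one>" and SS: "adj A S2 \<otimes> S2 = \<one>"
    and SU: "S2 \<otimes> U = U \<otimes> (U \<otimes> S2)"
    and sum: "S2 \<otimes> adj A S2 \<oplus> U \<otimes> (S2 \<otimes> (adj A S2 \<otimes> adj A U)) = \<one>"
    using assms by (auto simp: two_adic_relations_def cstar_unitary_def cstar_isometry_def
        numeral_2_eq_2 m_assoc)
  have cancel: "adj A U \<otimes> (U \<otimes> x) = x" "adj A S2 \<otimes> (S2 \<otimes> x) = x" if "x \<in> carrier A" for x
    using that UU SS by (simp_all flip: m_assoc)
  let ?z = "adj A S2 \<otimes> (U \<otimes> S2)"
  have "?z = adj A S2 \<otimes> ((S2 \<otimes> adj A S2 \<oplus> U \<otimes> (S2 \<otimes> (adj A S2 \<otimes> adj A U))) \<otimes> (U \<otimes> S2))"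
    by (simp add: sum)
  also have "\<dots> = ?z \<oplus> ?z"
    by (simp add: l_distr r_distr m_assoc cancel SS)
  finally have "?z \<ominus> ?z = (?z \<oplus> ?z) \<ominus> ?z" by simp
  then have z: "?z = \<zero>" by (simp add: a_minus_def a_assoc r_neg)
  show ?thesis
    by (intro doubling_pair.intro doubling_pair_axioms.intro cstar_algebra_axioms)
       (simp_all add: UU SS SU z adj_mult m_assoc cancel)
qed

theorem theorem3p20:
  fixes Q :: "'a cstar_alg" and U S2 S1 w :: 'a
  assumes "is_two_adic_ring_cstar Q U S2"
    and "S1 = U \<otimes>\<^bsub>Q\<^esub> S2"
    and "cstar_unitary Q w"
    and "w \<otimes>\<^bsub>Q\<^esub> S1 \<otimes>\<^bsub>Q\<^esub> adj Q w = S1"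
  shows "\<exists>z::complex. cmod z = 1 \<and> w = z \<odot>\<^bsub>Q\<^esub> \<one>\<^bsub>Q\<^esub>"
proof -
  interpret cstar_algebra Q using assms(1) by (simp add: is_two_adic_ring_cstar_def)
  have rel: "two_adic_relations Q U S2" using assms(1) by (simp add: is_two_adic_ring_cstar_def)
  then have c [simp]: "U \<in> carrier Q" "S2 \<in> carrier Q" and UU: "adj Q U \<otimes>\<^bsub>Q\<^esub> U = \<one>\<^bsub>Q\<^esub>"
    by (auto simp: two_adic_relations_def cstar_unitary_def cstar_isometry_def)
  have w [simp]: "w \<in> carrier Q" and ww: "adj Q w \<otimes>\<^bsub>Q\<^esub> w = \<one>\<^bsub>Q\<^esub>"
    using assms(3) by (auto simp: cstar_unitary_def)
  have [simp]: "S1 \<in> carrier Q" by (simp add: assms(2))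
  interpret doubling_pair Q U S1
    unfolding assms(2) by (rule two_adic_doubling_pair[OF rel])
  let ?X = "star_algebra_generated Q {U, S1}"
  have "adj Q U \<otimes>\<^bsub>Q\<^esub> S1 = S2" using UU by (simp add: assms(2) flip: m_assoc)
  then have "U \<in> ?X" "S2 \<in> ?X"
    by (metis insertCI star_algebra_generated.incl star_algebra_generated.adj
        star_algebra_generated.mult)+
  then have gen: "w \<in> norm_closure Q ?X"
    using two_adic_norm_closure[OF assms(1) star_subalgebra_generated] by simp
  have commute: "w \<otimes>\<^bsub>Q\<^esub> x = x \<otimes>\<^bsub>Q\<^esub> w"
    if "x \<in> carrier Q" "w \<otimes>\<^bsub>Q\<^esub> x \<otimes>\<^bsub>Q\<^esub> adj Q w = x" for x
  proof -
    have "x \<otimes>\<^bsub>Q\<^esub> w = (w \<otimes>\<^bsub>Q\<^esub> x \<otimes>\<^bsub>Q\<^esub> adj Q w) \<otimes>\<^bsub>Q\<^esub> w" by (simp only: that)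
    then show ?thesis using that(1) by (simp add: m_assoc ww)
  qed
  have "adj Q (w \<otimes>\<^bsub>Q\<^esub> S1 \<otimes>\<^bsub>Q\<^esub> adj Q w) = adj Q S1" using assms(4) by simp
  then have "w \<otimes>\<^bsub>Q\<^esub> adj Q S1 \<otimes>\<^bsub>Q\<^esub> adj Q w = adj Q S1" by (simp add: adj_mult m_assoc)
  then obtain z where z: "w = z \<odot>\<^bsub>Q\<^esub> \<one>\<^bsub>Q\<^esub>"
    using relative_commutant_trivial[OF gen] commute assms(4) by auto
  show ?thesis
  proof (cases "\<one>\<^bsub>Q\<^esub> = \<zero>\<^bsub>Q\<^esub>")
    case True
    \<comment> \<open>In the zero algebra \<open>z\<close> is arbitrary, so it has to be chosen of modulus one.\<close>
    then show ?thesis using z by (intro exI[of _ 1]) simp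
  next
    case False
    then have "nrm Q \<one>\<^bsub>Q\<^esub> \<noteq> 0" by (simp add: nrm_eq_0_iff)
    moreover have "(nrm Q w)\<^sup>2 = nrm Q \<one>\<^bsub>Q\<^esub>" using cstar_identity[of w] ww by simp
    moreover have "(nrm Q \<one>\<^bsub>Q\<^esub>)\<^sup>2 = nrm Q \<one>\<^bsub>Q\<^esub>" using cstar_identity[of "\<one>\<^bsub>Q\<^esub>"] by simp
    ultimately have "(cmod z)\<^sup>2 = 1" by (simp add: z nrm_smult power_mult_distrib)
    then have "cmod z = 1 \<or> cmod z = - 1" by (simp only: power2_eq_1_iff)
    then have "cmod z = 1" using norm_ge_zero[of z] by linarith
    then show ?thesis using z by blast
  qed
qed

end
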